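(* Let $f:M\to M$ be a partially hyperbolic diffeomorphism of a closed manifold $M$, and let $\mathfrak{F}^c$ be a center foliation of $f$. If $f$ is expansive with respect to $\mathfrak{F}^c$ and topologically stable with respect to $\mathfrak{F}^c$, then $$CR^c(f)\subset\overline{Per^c(f)}\subset\Omega^c(f).$$
   Context: A closed manifold is a compact connected boundaryless $C^\infty$ Riemannian manifold $M$; $d$ is its distance. Partial hyperbolicity. A diffeomorphism $f:M\to M$ is partially hyperbolic if there are constants $\lambda<\hat\gamma<1<\gamma<\mu$, $C\ge 1$, and a $Df$-invariant tangent bundle splitting $TM=E^s\oplus E^c\oplus E^u$ such that for every $x\in M$ and $n>0$: $\|Df^n(x)v^s\|\le C\lambda^n\|v^s\|$ for all $v^s\in E^s_x$; $C^{-1}\hat\gamma^n\|v^c\|\le\|Df^n(x)v^c\|\le C\gamma^n\|v^c\|$ for all $v^c\in E^c_x$; $C^{-1}\mu^n\|v^u\|\le\|Df^n(x)v^u\|$ for all $v^u\in E^u_x$. A center foliation of $f$ is a foliation $\mathfrak{F}^c$ tangent to $E^c$ which is $f$-invariant (its leaves are permuted by $f$). Dynamical coherence is not assumed. Leaf notation. For a foliation $\mathfrak{F}$ of $M$, $\mathfrak{F}(x)$ is the leaf containing $x$, $d_L$ is the intrinsic metric on a leaf $L$, and for $\epsilon>0$, $\mathfrak{F}_\epsilon(x)=\{y\in\mathfrak{F}(x): d_{\mathfrak{F}(x)}(x,y)\le\epsilon\}$. A set $S\subset M$ is saturated if $\mathfrak{F}(x)\subset S$ for every $x\in S$. For a point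 $y$ and set $B$, $\operatorname{dist}(y,B)=\inf_{z\in B}d(y,z)$. Expansivity with respect to $\mathfrak{F}$. An $(\mathfrak{F},\epsilon)$-orbit of $f$ is a bi-infinite sequence $(x_k)_{k\in\mathbb{Z}}$ with $f(x_k)\in\mathfrak{F}_\epsilon(x_{k+1})$ for all $k\in\mathbb{Z}$. $f$ is expansive with respect to $\mathfrak{F}$ if for every $\epsilon_0>0$ there is $e>0$ such that if $(x_k)_{k\in\mathbb{Z}}$ and $(y_k)_{k\in\mathbb{Z}}$ are $(\mathfrak{F},e)$-orbits with $d(x_k,y_k)\le e$ for all $k\in\mathbb{Z}$, then $y_0\in\mathfrak{F}_{\epsilon_0}(x_0)$. Set-valued maps. A set-valued map is a map $H:M\to 2^M$ (into subsets of $M$) with $H(x)\ne\emptyset$ for all $x$; it is compact-valued if every $H(x)$ is compact. $H$ is $\mathfrak{F}$-valued with valuation constant $e>0$ if $H(x)\subset\bigcap_{y\in H(x)}\mathfrak{F}_e(y)$ for all $x\in M$. $H$ is continuous with respect to $\mathfrak{F}$ with (valuation) constant $\epsilon$ if $H$ is $\mathfrak{F}$-valued with valuation constant $\epsilon$ and for every $\rho>0$ there is $\Delta>0$ such that whenever $x,x'\in M$ and $d(x,x')\le\Delta$, one has $\operatorname{dist}(y,\mathfrak{F}_\epsilon(y'))\le\rho$ for all $(y,y')\in H(x)\times H(x')$. Topological stability with respect to $\mathfrak{F}$. Let $d_{C^0}(f,g)=\sup_{x\in M}d(f(x),g(x))$ for maps $f,g:M\to M$, $i_M$ the identity of $M$,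 and $d_{C^0}(H,i_M)=\sup_{x\in M}\sup_{y\in H(x)}d(y,x)$. A homeomorphism $f:M\to M$ is topologically stable with respect to $\mathfrak{F}$ if for every $\epsilon>0$ there is $\delta>0$ such that for every homeomorphism $g:M\to M$ with $d_{C^0}(f,g)\le\delta$ there is a compact-valued map $H:M\to 2^M$ which is continuous with respect to $\mathfrak{F}$ with constant $\epsilon$ and satisfies $d_{C^0}(H,i_M)\le\epsilon$ and $f(H(x))\subset\bigcup_{y\in H(g(x))}\mathfrak{F}_\epsilon(y)$ for all $x\in M$. Recurrence sets. $x\in M$ is center periodic if $\mathfrak{F}^c(f^k(x))=\mathfrak{F}^c(x)$ for some $k\ge1$. $x$ is center nonwandering if for every saturated (with respect to $\mathfrak{F}^c$) open neighborhood $U$ of $x$ there is $n\ge1$ with $f^n(U)\cap U\ne\emptyset$. Given $\delta>0$, an $(\mathfrak{F}^c,\delta)$-chain from $x$ to $y$ is a finite sequence $x_0,\dots,x_r$ with $r\ge1$, $x_0=x$, $x_r=y$ and $\operatorname{dist}(f(x_i),\mathfrak{F}^c_\delta(x_{i+1}))\le\delta$ for all $0\le i\le r-1$. $x$ is center chain recurrent if for every $\delta>0$ there is an $(\mathfrak{F}^c,\delta)$-chain from $x$ to $x$. $Per^c(f)$, $\Omega^c(f)$ and $CR^c(f)$ denote the sets of center periodic, center nonwandering and center chain recurrent points, respectively. *)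

theory Defs
  imports "HOL-Analysis.Analysis"
begin

section \<open>Smooth atlases and tangent vectors\<close>

(* Only meant for open S. *)
primrec Ck_on :: "nat \<Rightarrow> ('a::euclidean_space \<Rightarrow> 'b::real_normed_vector) \<Rightarrow> 'a set \<Rightarrow> bool" where
  "Ck_on 0 h S \<longleftrightarrow> continuous_on S h"
| "Ck_on (Suc k) h S \<longleftrightarrow>
     (\<forall>x\<in>S. h differentiable (at x)) \<and> (\<forall>v. Ck_on k (\<lambda>x. frechet_derivative h (at x) v) S)"

definition smooth_on :: "('a::euclidean_space \<Rightarrow> 'b::real_normed_vector) \<Rightarrow> 'a set \<Rightarrow> bool" where
  "smooth_on h S \<longleftrightarrow> (\<forall>k. Ck_on k h S)"

(* The manifold M is a whole type 'a.  A chart is a pair (domain, coordinate map); the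
   dimension of M is DIM('e). *)
type_synonym ('a, 'e) chart = "'a set \<times> ('a \<Rightarrow> 'e)"

definition chart_inv :: "('a, 'e) chart \<Rightarrow> 'e \<Rightarrow> 'a" where
  "chart_inv c = inv_into (fst c) (snd c)"

definition smooth_atlas :: "('a::topological_space, 'e::euclidean_space) chart set \<Rightarrow> bool" where
  "smooth_atlas A \<longleftrightarrow>
     (\<Union>c\<in>A. fst c) = UNIV \<and>
     (\<forall>c\<in>A. open (fst c) \<and> open (snd c ` fst c) \<and>
             homeomorphism (fst c) (snd c ` fst c) (snd c) (chart_inv c)) \<and>
     (\<forall>c\<in>A. \<forall>c'\<in>A. smooth_on (snd c' \<circ> chart_inv c) (snd c ` (fst c \<inter> fst c')))"

(* Tangent vectors at x are represented by their coordinates in one preferred chart around x,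
   so that every tangent space is a copy of 'e. *)
definition chart_at :: "('a, 'e) chart set \<Rightarrow> 'a \<Rightarrow> ('a, 'e) chart" where
  "chart_at A x = (SOME c. c \<in> A \<and> x \<in> fst c)"

definition transition_deriv ::
  "('a, 'e::euclidean_space) chart \<Rightarrow> ('a, 'e) chart \<Rightarrow> 'a \<Rightarrow> 'e \<Rightarrow> 'e" where
  "transition_deriv c c' x = frechet_derivative (snd c' \<circ> chart_inv c) (at (snd c x))"

(* Coordinates in the chart c of the tangent vector v at x, and the inverse operation. *)
definition to_chart ::
  "('a, 'e::euclidean_space) chart set \<Rightarrow> ('a, 'e) chart \<Rightarrow> 'a \<Rightarrow> 'e \<Rightarrow> 'e" where
  "to_chart A c x = transition_deriv (chart_at A x) c x"

definition from_chart ::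
  "('a, 'e::euclidean_space) chart set \<Rightarrow> ('a, 'e) chart \<Rightarrow> 'a \<Rightarrow> 'e \<Rightarrow> 'e" where
  "from_chart A c x = transition_deriv c (chart_at A x) x"

definition tangent_map ::
  "('a, 'e::euclidean_space) chart set \<Rightarrow> ('a \<Rightarrow> 'a) \<Rightarrow> 'a \<Rightarrow> 'e \<Rightarrow> 'e" where
  "tangent_map A f x =
     frechet_derivative (snd (chart_at A (f x)) \<circ> f \<circ> chart_inv (chart_at A x))
       (at (snd (chart_at A x) x))"

definition C1_map ::
  "('a::topological_space, 'e::euclidean_space) chart set \<Rightarrow> ('a \<Rightarrow> 'a) \<Rightarrow> bool" where
  "C1_map A f \<longleftrightarrow> continuous_on UNIV f \<and>
     (\<forall>c\<in>A. \<forall>c'\<in>A. Ck_on 1 (snd c' \<circ> f \<circ> chart_inv c) (snd c ` (fst c \<inter> f -` fst c')))"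

definition diffeomorphism ::
  "('a::topological_space, 'e::euclidean_space) chart set \<Rightarrow> ('a \<Rightarrow> 'a) \<Rightarrow> bool" where
  "diffeomorphism A f \<longleftrightarrow> bij f \<and> C1_map A f \<and> C1_map A (inv f)"

section \<open>Riemannian metrics, lengths and intrinsic distances\<close>

definition riemannian_metric ::
  "('a::topological_space, 'e::euclidean_space) chart set \<Rightarrow> ('a \<Rightarrow> 'e \<Rightarrow> 'e \<Rightarrow> real) \<Rightarrow> bool" where
  "riemannian_metric A G \<longleftrightarrow>
     (\<forall>x. bilinear (G x) \<and> (\<forall>v w. G x v w = G x w v) \<and> (\<forall>v. v \<noteq> 0 \<longrightarrow> G x v v > 0)) \<and>
     (\<forall>c\<in>A. \<forall>v w. smooth_on
        (\<lambda>p. let x = chart_inv c p in G x (from_chart A c x v) (from_chart A c x w))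
        (snd c ` fst c))"

definition tnorm :: "('a \<Rightarrow> 'e \<Rightarrow> 'e \<Rightarrow> real) \<Rightarrow> 'a \<Rightarrow> 'e \<Rightarrow> real" where
  "tnorm G x v = sqrt (G x v v)"

(* C^1 on the closed interval, with one-sided derivatives at the end points.  The library's
   C1_differentiable_on is not suitable piecewise: it admits velocities that are unbounded
   near the break points, and the length integral could then fail to exist. *)
definition C1_curve_on ::
  "('a::topological_space, 'e::euclidean_space) chart set \<Rightarrow> (real \<Rightarrow> 'a) \<Rightarrow> real \<Rightarrow> real \<Rightarrow> bool" where
  "C1_curve_on A \<gamma> a b \<longleftrightarrow> continuous_on {a..b} \<gamma> \<and>
     (\<forall>c\<in>A. \<exists>D. continuous_on ({a..b} \<inter> \<gamma> -` fst c) D \<and>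
        (\<forall>t \<in> {a..b} \<inter> \<gamma> -` fst c.
           ((\<lambda>s. snd c (\<gamma> s)) has_vector_derivative D t) (at t within {a..b})))"

definition piecewise_C1_curve ::
  "('a::topological_space, 'e::euclidean_space) chart set \<Rightarrow> (real \<Rightarrow> 'a) \<Rightarrow> bool" where
  "piecewise_C1_curve A \<gamma> \<longleftrightarrow>
     (\<exists>n (t::nat \<Rightarrow> real). t 0 = 0 \<and> t n = 1 \<and>
        (\<forall>i<n. t i < t (Suc i) \<and> C1_curve_on A \<gamma> (t i) (t (Suc i))))"

(* The velocity is the right one outside the finitely many break points. *)
definition velocity ::
  "('a, 'e::euclidean_space) chart set \<Rightarrow> (real \<Rightarrow> 'a) \<Rightarrow> real \<Rightarrow> 'e" where
  "velocity A \<gamma> t = vector_derivative (\<lambda>s. snd (chart_at A (\<gamma> t)) (\<gamma> s)) (at t)"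

definition curve_length ::
  "('a, 'e::euclidean_space) chart set \<Rightarrow> ('a \<Rightarrow> 'e \<Rightarrow> 'e \<Rightarrow> real) \<Rightarrow> (real \<Rightarrow> 'a) \<Rightarrow> real" where
  "curve_length A G \<gamma> = integral {0..1} (\<lambda>t. tnorm G (\<gamma> t) (velocity A \<gamma> t))"

(* Infimum of the lengths of curves inside S: the Riemannian distance for S = UNIV, and the
   intrinsic metric of S if S is a leaf of a foliation.  It is \<infinity> if no such curve exists. *)
definition intrinsic_dist ::
  "('a::topological_space, 'e::euclidean_space) chart set \<Rightarrow> ('a \<Rightarrow> 'e \<Rightarrow> 'e \<Rightarrow> real) \<Rightarrow>
     'a set \<Rightarrow> 'a \<Rightarrow> 'a \<Rightarrow> ereal" where
  "intrinsic_dist A G S x y =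
     (INF \<gamma> \<in> {\<gamma>. piecewise_C1_curve A \<gamma> \<and> \<gamma> ` {0..1} \<subseteq> S \<and> \<gamma> 0 = x \<and> \<gamma> 1 = y}.
        ereal (curve_length A G \<gamma>))"

(* The metric of the type 'a is the Riemannian distance, so dist, open, compact, infdist etc.
   have their library meaning on M. *)
definition closed_riemannian_manifold ::
  "('a::metric_space, 'e::euclidean_space) chart set \<Rightarrow> ('a \<Rightarrow> 'e \<Rightarrow> 'e \<Rightarrow> real) \<Rightarrow> bool" where
  "closed_riemannian_manifold A G \<longleftrightarrow>
     smooth_atlas A \<and> riemannian_metric A G \<and>
     compact (UNIV :: 'a set) \<and> connected (UNIV :: 'a set) \<and>
     (\<forall>x y :: 'a. intrinsic_dist A G UNIV x y = ereal (dist x y))"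

section \<open>Partial hyperbolicity\<close>

definition continuous_subbundle ::
  "('a::topological_space, 'e::euclidean_space) chart set \<Rightarrow> ('a \<Rightarrow> 'e set) \<Rightarrow> bool" where
  "continuous_subbundle A E \<longleftrightarrow>
     (\<forall>x. \<exists>U k (X :: nat \<Rightarrow> 'a \<Rightarrow> 'e). open U \<and> x \<in> U \<and>
        (\<forall>i<k. \<forall>c\<in>A. continuous_on (U \<inter> fst c) (\<lambda>y. to_chart A c y (X i y))) \<and>
        (\<forall>y\<in>U. E y = span ((\<lambda>i. X i y) ` {..<k}) \<and> dim (E y) = k))"

definition tangent_splitting ::
  "('a::topological_space, 'e::euclidean_space) chart set \<Rightarrow>
     ('a \<Rightarrow> 'e set) \<Rightarrow> ('a \<Rightarrow> 'e set) \<Rightarrow> ('a \<Rightarrow> 'e set) \<Rightarrow> bool" where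
  "tangent_splitting A Es Ec Eu \<longleftrightarrow>
     continuous_subbundle A Es \<and> continuous_subbundle A Ec \<and> continuous_subbundle A Eu \<and>
     (\<forall>x v. \<exists>!(vs, vc, vu). vs \<in> Es x \<and> vc \<in> Ec x \<and> vu \<in> Eu x \<and> v = vs + vc + vu)"

definition partially_hyperbolic ::
  "('a::topological_space, 'e::euclidean_space) chart set \<Rightarrow> ('a \<Rightarrow> 'e \<Rightarrow> 'e \<Rightarrow> real) \<Rightarrow> ('a \<Rightarrow> 'a) \<Rightarrow>
     ('a \<Rightarrow> 'e set) \<Rightarrow> ('a \<Rightarrow> 'e set) \<Rightarrow> ('a \<Rightarrow> 'e set) \<Rightarrow> bool" where
  "partially_hyperbolic A G f Es Ec Eu \<longleftrightarrow>
     tangent_splitting A Es Ec Eu \<and>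
     (\<forall>x. tangent_map A f x ` Es x = Es (f x) \<and> tangent_map A f x ` Ec x = Ec (f x) \<and>
          tangent_map A f x ` Eu x = Eu (f x)) \<and>
     (\<exists>\<nu> \<gamma>' \<gamma> \<mu> C :: real. \<nu> < \<gamma>' \<and> \<gamma>' < 1 \<and> 1 < \<gamma> \<and> \<gamma> < \<mu> \<and> C \<ge> 1 \<and>
        (\<forall>x. \<forall>n>0.
           (\<forall>v \<in> Es x. tnorm G ((f ^^ n) x) (tangent_map A (f ^^ n) x v) \<le> C * \<nu> ^ n * tnorm G x v) \<and>
           (\<forall>v \<in> Ec x.
              inverse C * \<gamma>' ^ n * tnorm G x v \<le> tnorm G ((f ^^ n) x) (tangent_map A (f ^^ n) x v) \<and>
              tnorm G ((f ^^ n) x) (tangent_map A (f ^^ n) x v) \<le> C * \<gamma> ^ n * tnorm G x v) \<and>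
           (\<forall>v \<in> Eu x.
              inverse C * \<mu> ^ n * tnorm G x v \<le> tnorm G ((f ^^ n) x) (tangent_map A (f ^^ n) x v))))"

section \<open>Foliations\<close>

(* P is the linear subspace of plaque directions; its dimension, possibly 0 or DIM('e), is the
   dimension of the leaves. *)
definition foliation_cube :: "'e::euclidean_space set \<Rightarrow> 'e set" where
  "foliation_cube P = {a + b | a b. a \<in> P \<and> norm a < 1 \<and> (\<forall>p\<in>P. b \<bullet> p = 0) \<and> norm b < 1}"

(* The plaques \<phi>^{-1}((z + P) \<inter> foliation_cube P) are exactly the components of the intersections
   of the leaves with U.  The box is only a homeomorphism, but it restricts to C^1 immersions of
   the plaques, which vary continuously in the C^1 sense. *)
definition foliation_box ::
  "('a::topological_space, 'e::euclidean_space) chart set \<Rightarrow> ('a \<Rightarrow> 'a set) \<Rightarrow> 'e set \<Rightarrow>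
     ('a, 'e) chart \<Rightarrow> bool" where
  "foliation_box A F P B \<longleftrightarrow> (case B of (U, \<phi>) \<Rightarrow>
     open U \<and> homeomorphism U (foliation_cube P) \<phi> (chart_inv (U, \<phi>)) \<and>
     (\<forall>x\<in>U. connected_component_set (F x \<inter> U) x = {y \<in> U. \<phi> y - \<phi> x \<in> P}) \<and>
     (\<forall>c\<in>A. \<exists>D :: 'e \<Rightarrow> 'e \<Rightarrow> 'e.
        (\<forall>v\<in>P. continuous_on (\<phi> ` (U \<inter> fst c)) (\<lambda>z. D z v)) \<and>
        (\<forall>z \<in> \<phi> ` (U \<inter> fst c).
           ((\<lambda>p. snd c (chart_inv (U, \<phi>) (z + p))) has_derivative D z) (at 0 within P) \<and>
           inj_on (D z) P)))"

(* F x is the leaf through x.  A leaf meets a box in at most countably many plaques, so paths in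
   the subspace topology of a leaf are also continuous for its leaf topology; path connectedness
   therefore says that leaves are connected as immersed manifolds.  Connectedness in the
   subspace topology would not be enough. *)
definition foliation ::
  "('a::topological_space, 'e::euclidean_space) chart set \<Rightarrow> ('a \<Rightarrow> 'a set) \<Rightarrow> bool" where
  "foliation A F \<longleftrightarrow>
     (\<forall>x. x \<in> F x) \<and> (\<forall>x. \<forall>y \<in> F x. F y = F x) \<and> (\<forall>x. path_connected (F x)) \<and>
     (\<exists>P. subspace P \<and> (\<forall>x. \<exists>U \<phi>. x \<in> U \<and> foliation_box A F P (U, \<phi>)))"

(* Initial velocities of the C^1 curves in the leaf that start at x. *)
definition leaf_tangent_space ::
  "('a::topological_space, 'e::euclidean_space) chart set \<Rightarrow> ('a \<Rightarrow> 'a set) \<Rightarrow> 'a \<Rightarrow> 'e set" where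
  "leaf_tangent_space A F x =
     {v. \<exists>\<gamma>. C1_curve_on A \<gamma> 0 1 \<and> \<gamma> ` {0..1} \<subseteq> F x \<and> \<gamma> 0 = x \<and>
          ((\<lambda>s. snd (chart_at A x) (\<gamma> s)) has_vector_derivative v) (at 0 within {0..1})}"

definition center_foliation ::
  "('a::topological_space, 'e::euclidean_space) chart set \<Rightarrow> ('a \<Rightarrow> 'a) \<Rightarrow> ('a \<Rightarrow> 'e set) \<Rightarrow>
     ('a \<Rightarrow> 'a set) \<Rightarrow> bool" where
  "center_foliation A f Ec F \<longleftrightarrow>
     foliation A F \<and> (\<forall>x. leaf_tangent_space A F x = Ec x) \<and> (\<forall>x. f ` F x = F (f x))"

definition leaf_ball ::
  "('a::topological_space, 'e::euclidean_space) chart set \<Rightarrow> ('a \<Rightarrow> 'e \<Rightarrow> 'e \<Rightarrow> real) \<Rightarrow>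
     ('a \<Rightarrow> 'a set) \<Rightarrow> real \<Rightarrow> 'a \<Rightarrow> 'a set" where
  "leaf_ball A G F \<epsilon> x = {y \<in> F x. intrinsic_dist A G (F x) x y \<le> ereal \<epsilon>}"

definition saturated :: "('a \<Rightarrow> 'a set) \<Rightarrow> 'a set \<Rightarrow> bool" where
  "saturated F S \<longleftrightarrow> (\<forall>x\<in>S. F x \<subseteq> S)"

section \<open>Expansivity and topological stability with respect to a foliation\<close>

definition leaf_orbit ::
  "('a::topological_space, 'e::euclidean_space) chart set \<Rightarrow> ('a \<Rightarrow> 'e \<Rightarrow> 'e \<Rightarrow> real) \<Rightarrow>
     ('a \<Rightarrow> 'a set) \<Rightarrow> ('a \<Rightarrow> 'a) \<Rightarrow> real \<Rightarrow> (int \<Rightarrow> 'a) \<Rightarrow> bool" where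
  "leaf_orbit A G F f \<epsilon> x \<longleftrightarrow> (\<forall>k. f (x k) \<in> leaf_ball A G F \<epsilon> (x (k + 1)))"

definition expansive_wrt ::
  "('a::metric_space, 'e::euclidean_space) chart set \<Rightarrow> ('a \<Rightarrow> 'e \<Rightarrow> 'e \<Rightarrow> real) \<Rightarrow>
     ('a \<Rightarrow> 'a set) \<Rightarrow> ('a \<Rightarrow> 'a) \<Rightarrow> bool" where
  "expansive_wrt A G F f \<longleftrightarrow>
     (\<forall>\<epsilon>\<^sub>0>0. \<exists>e>0. \<forall>x y. leaf_orbit A G F f e x \<longrightarrow> leaf_orbit A G F f e y \<longrightarrow>
        (\<forall>k. dist (x k) (y k) \<le> e) \<longrightarrow> y 0 \<in> leaf_ball A G F \<epsilon>\<^sub>0 (x 0))"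

definition set_valued_map :: "('a \<Rightarrow> 'a set) \<Rightarrow> bool" where
  "set_valued_map H \<longleftrightarrow> (\<forall>x. H x \<noteq> {})"

definition compact_valued :: "('a::topological_space \<Rightarrow> 'a set) \<Rightarrow> bool" where
  "compact_valued H \<longleftrightarrow> (\<forall>x. compact (H x))"

definition leaf_valued ::
  "('a::topological_space, 'e::euclidean_space) chart set \<Rightarrow> ('a \<Rightarrow> 'e \<Rightarrow> 'e \<Rightarrow> real) \<Rightarrow>
     ('a \<Rightarrow> 'a set) \<Rightarrow> real \<Rightarrow> ('a \<Rightarrow> 'a set) \<Rightarrow> bool" where
  "leaf_valued A G F e H \<longleftrightarrow> (\<forall>x. H x \<subseteq> (\<Inter>y \<in> H x. leaf_ball A G F e y))"

definition continuous_wrt ::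
  "('a::metric_space, 'e::euclidean_space) chart set \<Rightarrow> ('a \<Rightarrow> 'e \<Rightarrow> 'e \<Rightarrow> real) \<Rightarrow>
     ('a \<Rightarrow> 'a set) \<Rightarrow> real \<Rightarrow> ('a \<Rightarrow> 'a set) \<Rightarrow> bool" where
  "continuous_wrt A G F \<epsilon> H \<longleftrightarrow> leaf_valued A G F \<epsilon> H \<and>
     (\<forall>\<rho>>0. \<exists>\<Delta>>0. \<forall>x x'. dist x x' \<le> \<Delta> \<longrightarrow>
        (\<forall>y \<in> H x. \<forall>y' \<in> H x'. infdist y (leaf_ball A G F \<epsilon> y') \<le> \<rho>))"

definition C0_dist :: "('a::metric_space \<Rightarrow> 'a) \<Rightarrow> ('a \<Rightarrow> 'a) \<Rightarrow> real" where
  "C0_dist f g = (SUP x. dist (f x) (g x))"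

definition C0_dist_id :: "('a::metric_space \<Rightarrow> 'a set) \<Rightarrow> real" where
  "C0_dist_id H = (SUP x. SUP y \<in> H x. dist y x)"

definition topologically_stable_wrt ::
  "('a::metric_space, 'e::euclidean_space) chart set \<Rightarrow> ('a \<Rightarrow> 'e \<Rightarrow> 'e \<Rightarrow> real) \<Rightarrow>
     ('a \<Rightarrow> 'a set) \<Rightarrow> ('a \<Rightarrow> 'a) \<Rightarrow> bool" where
  "topologically_stable_wrt A G F f \<longleftrightarrow>
     (\<forall>\<epsilon>>0. \<exists>\<delta>>0. \<forall>g. homeomorphism UNIV UNIV g (inv g) \<longrightarrow> C0_dist f g \<le> \<delta> \<longrightarrow>
        (\<exists>H. set_valued_map H \<and> compact_valued H \<and> continuous_wrt A G F \<epsilon> H \<and>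
             C0_dist_id H \<le> \<epsilon> \<and>
             (\<forall>x. f ` H x \<subseteq> (\<Union>y \<in> H (g x). leaf_ball A G F \<epsilon> y))))"

section \<open>Recurrence sets\<close>

definition center_periodic :: "('a \<Rightarrow> 'a set) \<Rightarrow> ('a \<Rightarrow> 'a) \<Rightarrow> 'a set" where
  "center_periodic F f = {x. \<exists>k\<ge>1. F ((f ^^ k) x) = F x}"

definition center_nonwandering ::
  "('a::topological_space \<Rightarrow> 'a set) \<Rightarrow> ('a \<Rightarrow> 'a) \<Rightarrow> 'a set" where
  "center_nonwandering F f =
     {x. \<forall>U. open U \<longrightarrow> x \<in> U \<longrightarrow> saturated F U \<longrightarrow> (\<exists>n\<ge>1. (f ^^ n) ` U \<inter> U \<noteq> {})}"

definition leaf_chain ::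
  "('a::metric_space, 'e::euclidean_space) chart set \<Rightarrow> ('a \<Rightarrow> 'e \<Rightarrow> 'e \<Rightarrow> real) \<Rightarrow>
     ('a \<Rightarrow> 'a set) \<Rightarrow> ('a \<Rightarrow> 'a) \<Rightarrow> real \<Rightarrow> 'a \<Rightarrow> 'a \<Rightarrow> bool" where
  "leaf_chain A G F f \<delta> x y \<longleftrightarrow>
     (\<exists>r\<ge>1. \<exists>z :: nat \<Rightarrow> 'a. z 0 = x \<and> z r = y \<and>
        (\<forall>i<r. infdist (f (z i)) (leaf_ball A G F \<delta> (z (i + 1))) \<le> \<delta>))"

definition center_chain_recurrent ::
  "('a::metric_space, 'e::euclidean_space) chart set \<Rightarrow> ('a \<Rightarrow> 'e \<Rightarrow> 'e \<Rightarrow> real) \<Rightarrow>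
     ('a \<Rightarrow> 'a set) \<Rightarrow> ('a \<Rightarrow> 'a) \<Rightarrow> 'a set" where
  "center_chain_recurrent A G F f = {x. \<forall>\<delta>>0. leaf_chain A G F f \<delta> x x}"

end

(* A center chain from x to x is in particular a periodic pseudo-orbit of f; choosing it of minimal
   length makes its points distinct.  If dim M >= 2, a homeomorphism h close to the identity
   corrects all its jumps at once, so that x is periodic for g = h o f, which is C^0-close to f.
   Topological stability gives H with f(H(y)) contained in the leaf of the points of H(g(y)).
   Following a point y0 of H(x) along the periodic g-orbit of x, its f-orbit stays in the leaves of
   the sets H(g^i(x)), hence returns to its own leaf: y0 is center periodic, and close to x.

   For h, points are moved inside small cells of charts.  Cells of one colour are disjoint, and the
   number of colours (2^dim for each of finitely many charts) does not depend on the size of the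
   cells, so that the displacements of the successive colours add up to something small.

   In dimension 1 points cannot pass each other.  There either the center direction is nontrivial
   and M is a single leaf, or a power of f or of its inverse would contract all lengths by 1/2,
   which is impossible on a compact M that is not a point. *)
theory Submission
  imports Defs
begin

section \<open>Moving finitely many points by small homeomorphisms\<close>

text \<open>The length of the pseudo-orbit is beyond control, so the distance from \<open>h\<close>
  to the identity must be bounded independently of the number of jumps. Correcting the jumps one
  after another would let displacements accumulate; grouping them by cells bounds the total by the
  number of colours times the diameter of a cell. A homeomorphism never merges points, so the
  sources and the targets must each be distinct, and so must every intermediate configuration
  between two colours; the latter costs a second pass over the colours.

  In dimension 1, if the center direction vanishes, the tangent space has room for only one of the
  other two summands, and connectedness makes it the same one everywhere. Since \<open>dist\<close>
  is an infimum of lengths of piecewise C^1 curves, a bound on the tangent map becomes a bound on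
  distances only once the images of such curves are known to be such curves; this is the purpose of
  the calculus in charts.\<close>

definition movable :: "'a::topological_space set \<Rightarrow> bool" where
  "movable Q \<longleftrightarrow> (\<forall>(I::nat set) x y. finite I \<longrightarrow> x ` I \<subseteq> Q \<longrightarrow> y ` I \<subseteq> Q \<longrightarrow>
     inj_on x I \<longrightarrow> inj_on y I \<longrightarrow>
     (\<exists>h k. homeomorphism UNIV UNIV h k \<and> (\<forall>i\<in>I. h (x i) = y i) \<and> (\<forall>z. z \<notin> Q \<longrightarrow> h z = z)))"

definition moves_within :: "'a set set \<Rightarrow> ('a \<Rightarrow> 'a) \<Rightarrow> bool" where
  "moves_within \<Q> h \<longleftrightarrow> (\<forall>x. h x = x \<or> (\<exists>Q\<in>\<Q>. x \<in> Q \<and> h x \<in> Q))"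

lemma moves_within_mono: "moves_within \<Q> h \<Longrightarrow> \<Q> \<subseteq> \<R> \<Longrightarrow> moves_within \<R> h"
  unfolding moves_within_def by blast

text \<open>By disjointness only the cell containing \<open>h x\<close> can carry the second move,
  so any number of moves of one colour displaces a point by at most the diameter of one cell. Metric
  bounds would add up instead.\<close>

lemma moves_within_comp:
  assumes "disjoint \<Q>" "moves_within \<Q> h" "moves_within \<Q> h'"
  shows "moves_within \<Q> (h' \<circ> h)"
  unfolding moves_within_def
proof
  fix x
  have a: "h x = x \<or> (\<exists>Q\<in>\<Q>. x \<in> Q \<and> h x \<in> Q)"
    and b: "h' (h x) = h x \<or> (\<exists>Q\<in>\<Q>. h x \<in> Q \<and> h' (h x) \<in> Q)"
    using assms by (auto simp: moves_within_def)
  have "Q = Q'" if "Q \<in> \<Q>" "Q' \<in> \<Q>" "z \<in> Q" "z \<in> Q'" for Q Q' z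
    using that assms(1) by (auto simp: disjoint_def)
  then show "(h' \<circ> h) x = x \<or> (\<exists>Q\<in>\<Q>. x \<in> Q \<and> (h' \<circ> h) x \<in> Q)"
    using a b by (metis comp_apply)
qed

lemma homeomorphism_UNIV_comp:
  assumes "homeomorphism UNIV UNIV h k" "homeomorphism UNIV UNIV h' k'"
  shows "homeomorphism UNIV UNIV (h' \<circ> h) (k \<circ> k')"
  using homeomorphism_compose[OF assms] .

lemma homeomorphism_UNIV_bij: "homeomorphism UNIV UNIV h k \<Longrightarrow> bij h"
  unfolding homeomorphism_def by (intro bijI injI) (metis UNIV_I)+

text \<open>Disjoint cells can be treated one by one, since each move fixes whatever lies outside
  its cell. Only finitely many cells contain a point that has to move, so the induction runs over
  these although \<open>\<Q>\<close> may be infinite.\<close>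

lemma move_points_in_family:
  fixes x y :: "nat \<Rightarrow> 'a::topological_space"
  assumes "disjoint \<Q>" "\<And>Q. Q \<in> \<Q> \<Longrightarrow> movable Q" "finite I" "inj_on x I" "inj_on y I"
    and "\<And>i. i \<in> I \<Longrightarrow> x i = y i \<or> (\<exists>Q\<in>\<Q>. x i \<in> Q \<and> y i \<in> Q)"
  shows "\<exists>h k. homeomorphism UNIV UNIV h k \<and> (\<forall>i\<in>I. h (x i) = y i) \<and> moves_within \<Q> h"
proof -
  have fin: "\<exists>h k. homeomorphism UNIV UNIV h k \<and> (\<forall>i\<in>I. h (x i) = y i) \<and> moves_within \<R> h"
    if "finite \<R>" "\<R> \<subseteq> \<Q>" "inj_on y I"
       "\<And>i. i \<in> I \<Longrightarrow> x i = y i \<or> (\<exists>Q\<in>\<R>. x i \<in> Q \<and> y i \<in> Q)" for \<R> y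
    using that
  proof (induction \<R> arbitrary: y rule: finite_induct)
    case empty
    then show ?case
      by (intro exI[of _ id]) (auto simp: homeomorphism_def moves_within_def)
  next
    case (insert Q \<R>)
    have disj: "disjoint (insert Q \<R>)"
      using assms(1) insert.prems(1) by (metis pairwise_subset)
    have other: "P = Q" if "P \<in> insert Q \<R>" "z \<in> P" "z \<in> Q" for P z
      using that disj by (auto simp: disjoint_def)
    have same: "x i \<in> Q \<longleftrightarrow> y i \<in> Q" if "i \<in> I" for i
      using insert.prems(3)[OF that]
    proof
      assume "\<exists>P\<in>insert Q \<R>. x i \<in> P \<and> y i \<in> P"
      then obtain P where "P \<in> insert Q \<R>" "x i \<in> P" "y i \<in> P" by blast
      then show ?thesis using other[of P] by metis
    qed simp
    \<comment> \<open>The other cells are treated first, with the points of \<open>Q\<close> frozen.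
      By \<open>same\<close> no target outside \<open>Q\<close> belongs to a source in
      \<open>Q\<close>, which keeps \<open>y'\<close> injective.\<close>
    define y' where "y' = (\<lambda>i. if x i \<in> Q then x i else y i)"
    have "inj_on y' I"
    proof (rule inj_onI)
      fix i j assume ij: "i \<in> I" "j \<in> I" "y' i = y' j"
      then have "x i \<in> Q \<longleftrightarrow> x j \<in> Q"
        using same[of i] same[of j] by (auto simp: y'_def split: if_splits)
      then show "i = j"
        using ij inj_onD[OF assms(4)] inj_onD[OF insert.prems(2)] by (auto simp: y'_def split: if_splits)
    qed
    moreover have "x i = y' i \<or> (\<exists>Q\<in>\<R>. x i \<in> Q \<and> y' i \<in> Q)" if "i \<in> I" for i
      using insert.prems(3)[OF that] unfolding y'_def by (cases "x i \<in> Q") auto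
    moreover have "\<R> \<subseteq> \<Q>" using insert.prems(1) by simp
    ultimately have "\<exists>h k. homeomorphism UNIV UNIV h k \<and> (\<forall>i\<in>I. h (x i) = y' i) \<and> moves_within \<R> h"
      by (intro insert.IH)
    then obtain h k where h: "homeomorphism UNIV UNIV h k" "\<forall>i\<in>I. h (x i) = y' i"
      "moves_within \<R> h" by blast
    have "movable Q" using assms(2) insert.prems(1) by auto
    moreover have "finite {i\<in>I. x i \<in> Q}" using assms(3) by auto
    moreover have "inj_on x {i\<in>I. x i \<in> Q}" "inj_on y {i\<in>I. x i \<in> Q}"
      using assms(4) insert.prems(2) by (auto simp: inj_on_def)
    moreover have "x ` {i\<in>I. x i \<in> Q} \<subseteq> Q" "y ` {i\<in>I. x i \<in> Q} \<subseteq> Q" using same by auto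
    ultimately have "\<exists>h k. homeomorphism UNIV UNIV h k \<and> (\<forall>i\<in>{i\<in>I. x i \<in> Q}. h (x i) = y i) \<and>
        (\<forall>z. z \<notin> Q \<longrightarrow> h z = z)"
      unfolding movable_def by blast
    then obtain h' k' where h': "homeomorphism UNIV UNIV h' k'"
      "\<And>i. i \<in> I \<Longrightarrow> x i \<in> Q \<Longrightarrow> h' (x i) = y i" "\<And>z. z \<notin> Q \<Longrightarrow> h' z = z"
      by blast
    have "inj h'" using homeomorphism_UNIV_bij[OF h'(1)] by (simp add: bij_is_inj)
    \<comment> \<open>If \<open>h' z\<close> lay outside \<open>Q\<close>, it would be a fixed
      point, and injectivity would give \<open>h' z = z\<close>.\<close>
    then have "h' z \<in> Q" if "z \<in> Q" for z
      using that h'(3) by (metis injD)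
    then have "moves_within (insert Q \<R>) h'"
      using h'(3) unfolding moves_within_def by blast
    then have "moves_within (insert Q \<R>) (h' \<circ> h)"
      using moves_within_comp[OF disj] moves_within_mono[OF h(3)] by blast
    moreover have "(h' \<circ> h) (x i) = y i" if "i \<in> I" for i
    proof (cases "x i \<in> Q")
      case True
      then have "h (x i) = x i" using h(2) that by (simp add: y'_def)
      then show ?thesis using h'(2)[OF that True] by simp
    next
      case False
      then have "h (x i) = y i" using h(2) that by (simp add: y'_def)
      then show ?thesis using h'(3)[of "y i"] False same[OF that] by simp
    qed
    ultimately show ?case
      using homeomorphism_UNIV_comp[OF h(1) h'(1)] by blast
  qed
  have "\<forall>i\<in>I. \<exists>Q. x i \<noteq> y i \<longrightarrow> Q \<in> \<Q> \<and> x i \<in> Q \<and> y i \<in> Q"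
    using assms(6) by blast
  then obtain q where q: "\<And>i. i \<in> I \<Longrightarrow> x i \<noteq> y i \<Longrightarrow> q i \<in> \<Q> \<and> x i \<in> q i \<and> y i \<in> q i"
    by metis
  have "\<exists>h k. homeomorphism UNIV UNIV h k \<and> (\<forall>i\<in>I. h (x i) = y i) \<and>
      moves_within (q ` {i\<in>I. x i \<noteq> y i}) h"
  proof (rule fin)
    show "x i = y i \<or> (\<exists>Q\<in>q ` {i\<in>I. x i \<noteq> y i}. x i \<in> Q \<and> y i \<in> Q)" if "i \<in> I" for i
      using q[OF that] that by blast
  qed (use assms(3,5) q in auto)
  moreover have "q ` {i\<in>I. x i \<noteq> y i} \<subseteq> \<Q>" using q by auto
  ultimately show ?thesis using moves_within_mono by blast
qed

text \<open>Each colour displaces a point by at most one cell diameter \<open>\<eta>\<close>, whence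
  the factor \<open>card K\<close>. Between two colours some points are already at their targets and
  others still at their sources; the hypothesis \<open>x i \<noteq> y j\<close> keeps them
  apart.\<close>

lemma move_points_by_colours:
  fixes x y :: "nat \<Rightarrow> 'a::metric_space" and \<Q> :: "'c \<Rightarrow> 'a set set"
  assumes "finite K" "finite I" "inj_on x I" "inj_on y I"
    and disj: "\<And>c. c \<in> K \<Longrightarrow> disjoint (\<Q> c)"
    and mov: "\<And>c Q. c \<in> K \<Longrightarrow> Q \<in> \<Q> c \<Longrightarrow> movable Q"
    and diam: "\<And>c Q a b. c \<in> K \<Longrightarrow> Q \<in> \<Q> c \<Longrightarrow> a \<in> Q \<Longrightarrow> b \<in> Q \<Longrightarrow> dist a b \<le> \<eta>"
    and "\<eta> \<ge> 0"
    and ne: "\<And>i j. i \<in> I \<Longrightarrow> j \<in> I \<Longrightarrow> i \<noteq> j \<Longrightarrow> x i \<noteq> y j"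
    and "\<And>i. i \<in> I \<Longrightarrow> x i = y i \<or> (\<exists>c\<in>K. \<exists>Q\<in>\<Q> c. x i \<in> Q \<and> y i \<in> Q)"
  shows "\<exists>h k. homeomorphism UNIV UNIV h k \<and> (\<forall>i\<in>I. h (x i) = y i) \<and>
           (\<forall>z. dist z (h z) \<le> real (card K) * \<eta>)"
  using assms(1,4-)
proof (induction K arbitrary: y rule: finite_induct)
  case empty
  then show ?case
    by (intro exI[of _ id]) (auto simp: homeomorphism_def)
next
  case (insert c K)
  \<comment> \<open>The configuration after the colours in \<open>K\<close>: a point waits at its
    source if none of them can carry it.\<close>
  define y' where "y' = (\<lambda>i. if \<exists>c\<in>K. \<exists>Q\<in>\<Q> c. x i \<in> Q \<and> y i \<in> Q then y i else x i)"
  have y': "y' i = y i \<or> y' i = x i" for i by (auto simp: y'_def)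
  have inj: "inj_on y' I"
  proof (rule inj_onI)
    fix i j assume ij: "i \<in> I" "j \<in> I" "y' i = y' j"
    show "i = j"
      using y'[of i] y'[of j] ij(3) insert.prems(6)[OF ij(1,2)] insert.prems(6)[OF ij(2,1)]
        inj_onD[OF assms(3) _ ij(1,2)] inj_onD[OF insert.prems(1) _ ij(1,2)] by fastforce
  qed
  have "x i \<noteq> y' j" if "i \<in> I" "j \<in> I" "i \<noteq> j" for i j
    using y'[of j] insert.prems(6)[OF that] inj_onD[OF assms(3) _ that(1,2)] that(3) by metis
  moreover have "x i = y' i \<or> (\<exists>c\<in>K. \<exists>Q\<in>\<Q> c. x i \<in> Q \<and> y' i \<in> Q)" for i
    by (auto simp: y'_def)
  moreover have "disjoint (\<Q> c')" if "c' \<in> K" for c' using insert.prems(2) that by blast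
  moreover have "movable Q" if "c' \<in> K" "Q \<in> \<Q> c'" for c' Q using insert.prems(3) that by blast
  moreover have "dist a b \<le> \<eta>" if "c' \<in> K" "Q \<in> \<Q> c'" "a \<in> Q" "b \<in> Q" for c' Q a b
    using insert.prems(4) that by blast
  ultimately have "\<exists>h k. homeomorphism UNIV UNIV h k \<and> (\<forall>i\<in>I. h (x i) = y' i) \<and>
      (\<forall>z. dist z (h z) \<le> real (card K) * \<eta>)"
    by (intro insert.IH inj insert.prems(5))
  then obtain h k where h: "homeomorphism UNIV UNIV h k" "\<forall>i\<in>I. h (x i) = y' i"
    "\<And>z. dist z (h z) \<le> real (card K) * \<eta>" by blast
  have "\<exists>h k. homeomorphism UNIV UNIV h k \<and> (\<forall>i\<in>I. h (y' i) = y i) \<and> moves_within (\<Q> c) h"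
  proof (rule move_points_in_family)
    show "y' i = y i \<or> (\<exists>Q\<in>\<Q> c. y' i \<in> Q \<and> y i \<in> Q)" if "i \<in> I" for i
      using insert.prems(7)[OF that] unfolding y'_def by auto
    show "movable Q" if "Q \<in> \<Q> c" for Q using insert.prems(3)[OF _ that] by simp
  qed (simp_all add: insert.prems(1,2) assms(2) inj)
  then obtain h' k' where h': "homeomorphism UNIV UNIV h' k'" "\<forall>i\<in>I. h' (y' i) = y i"
    "moves_within (\<Q> c) h'" by blast
  have "dist z (h' z) \<le> \<eta>" for z
    using h'(3) insert.prems(4)[of c] \<open>\<eta> \<ge> 0\<close> unfolding moves_within_def
    by (metis dist_self insertI1)
  then have "dist z ((h' \<circ> h) z) \<le> real (card K) * \<eta> + \<eta>" for z
    using h(3)[of z] dist_triangle[of z "h' (h z)" "h z"] by (smt (verit) comp_apply)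
  moreover have "real (card K) * \<eta> + \<eta> = real (card (insert c K)) * \<eta>"
    using insert.hyps by (simp add: algebra_simps)
  ultimately show ?case
    using homeomorphism_UNIV_comp[OF h(1) h'(1)] h(2) h'(2) by (metis comp_apply)
qed

lemma choose_avoiding:
  fixes P :: "nat \<Rightarrow> 'a set"
  assumes "finite I" "\<And>i. i \<in> I \<Longrightarrow> infinite (P i)" "finite Z"
  shows "\<exists>m. inj_on m I \<and> (\<forall>i\<in>I. m i \<in> P i - Z)"
  using assms(1,2)
proof (induction I rule: finite_induct)
  case (insert i I)
  then obtain m where m: "inj_on m I" "\<forall>j\<in>I. m j \<in> P j - Z" by auto
  have "infinite (P i - (Z \<union> m ` I))"
    using insert.prems[of i] insert.hyps assms(3) by (simp add: Diff_infinite_finite)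
  then obtain w where w: "w \<in> P i - (Z \<union> m ` I)" using infinite_imp_nonempty by blast
  show ?case
    using m w insert.hyps by (intro exI[of _ "m(i := w)"]) (auto simp: inj_on_def)
qed auto

text \<open>Going through auxiliary points in general position removes coincidences between
  sources and targets, which would make two points collide between two colours.\<close>
lemma move_points_small:
  fixes x y :: "nat \<Rightarrow> 'a::metric_space" and \<Q> :: "'c \<Rightarrow> 'a set set"
  assumes "finite K" "finite I" "inj_on x I" "inj_on y I"
    and disj: "\<And>c. c \<in> K \<Longrightarrow> disjoint (\<Q> c)"
    and mov: "\<And>c Q. c \<in> K \<Longrightarrow> Q \<in> \<Q> c \<Longrightarrow> movable Q"
    and diam: "\<And>c Q a b. c \<in> K \<Longrightarrow> Q \<in> \<Q> c \<Longrightarrow> a \<in> Q \<Longrightarrow> b \<in> Q \<Longrightarrow> dist a b \<le> \<eta>"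
    and "\<eta> \<ge> 0"
    and cov: "\<And>a b. dist a b < \<delta> \<Longrightarrow> \<exists>c\<in>K. \<exists>Q\<in>\<Q> c. a \<in> Q \<and> b \<in> Q"
    and noiso: "\<And>a e. e > 0 \<Longrightarrow> infinite (ball (a::'a) e)"
    and close: "\<And>i. i \<in> I \<Longrightarrow> dist (x i) (y i) < \<delta>"
  shows "\<exists>h k. homeomorphism UNIV UNIV h k \<and> (\<forall>i\<in>I. h (x i) = y i) \<and>
           (\<forall>z. dist z (h z) \<le> 2 * real (card K) * \<eta>)"
proof -
  \<comment> \<open>The radius \<open>\<delta> - dist (x i) (y i)\<close> makes both legs, from
    \<open>x i\<close> to \<open>m i\<close> and from \<open>m i\<close> to \<open>y i\<close>,
    shorter than \<open>\<delta>\<close>. The two legs are the origin of the factor 2.\<close>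
  have "\<exists>m. inj_on m I \<and> (\<forall>i\<in>I. m i \<in> ball (x i) (\<delta> - dist (x i) (y i)) - (x ` I \<union> y ` I))"
    by (rule choose_avoiding) (simp_all add: assms(2) noiso close)
  then obtain m where m: "inj_on m I"
    "\<And>i. i \<in> I \<Longrightarrow> dist (x i) (m i) < \<delta> - dist (x i) (y i)"
    "\<And>i. i \<in> I \<Longrightarrow> m i \<notin> x ` I \<union> y ` I"
    by (metis Diff_iff mem_ball)
  have xm: "dist (x i) (m i) < \<delta>" if "i \<in> I" for i
    using m(2)[OF that] zero_le_dist[of "x i" "y i"] by linarith
  have my: "dist (m i) (y i) < \<delta>" if "i \<in> I" for i
    using m(2)[OF that] dist_triangle[of "m i" "y i" "x i"] by (simp add: dist_commute)
  have "\<exists>h k. homeomorphism UNIV UNIV h k \<and> (\<forall>i\<in>I. h (x i) = m i) \<and>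
           (\<forall>z. dist z (h z) \<le> real (card K) * \<eta>)"
  proof (rule move_points_by_colours[where \<Q>=\<Q>])
    show "x i \<noteq> m j" if "i \<in> I" "j \<in> I" "i \<noteq> j" for i j
      using m(3)[OF that(2)] that(1) by (metis UnI1 imageI)
    show "x i = m i \<or> (\<exists>c\<in>K. \<exists>Q\<in>\<Q> c. x i \<in> Q \<and> m i \<in> Q)" if "i \<in> I" for i
      using cov[OF xm[OF that]] by (rule disjI2)
  qed (simp_all add: assms(1-4,8) m(1) disj mov diam)
  then obtain h k where h: "homeomorphism UNIV UNIV h k" "\<forall>i\<in>I. h (x i) = m i"
    "\<And>z. dist z (h z) \<le> real (card K) * \<eta>" by blast
  have "\<exists>h k. homeomorphism UNIV UNIV h k \<and> (\<forall>i\<in>I. h (m i) = y i) \<and>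
           (\<forall>z. dist z (h z) \<le> real (card K) * \<eta>)"
  proof (rule move_points_by_colours[where \<Q>=\<Q>])
    show "m i \<noteq> y j" if "i \<in> I" "j \<in> I" "i \<noteq> j" for i j
      using m(3)[OF that(1)] that(2) by (metis UnI2 imageI)
    show "m i = y i \<or> (\<exists>c\<in>K. \<exists>Q\<in>\<Q> c. m i \<in> Q \<and> y i \<in> Q)" if "i \<in> I" for i
      using cov[OF my[OF that]] by (rule disjI2)
  qed (simp_all add: assms(1-4,8) m(1) disj mov diam)
  then obtain h' k' where h': "homeomorphism UNIV UNIV h' k'" "\<forall>i\<in>I. h' (m i) = y i"
    "\<And>z. dist z (h' z) \<le> real (card K) * \<eta>" by blast
  have "dist z ((h' \<circ> h) z) \<le> 2 * real (card K) * \<eta>" for z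
    using h(3)[of z] h'(3)[of "h z"] dist_triangle[of z "h' (h z)" "h z"] unfolding comp_apply mult.assoc by linarith
  then show ?thesis
    using homeomorphism_UNIV_comp[OF h(1) h'(1)] h(2) h'(2) by (metis comp_apply)
qed

section \<open>Coloured grids of small cells in Euclidean space\<close>

text \<open>The components of \<open>grid s B\<close> are the open cubes of side \<open>2 * s\<close> of a lattice that is shifted by
  \<open>s\<close> in the directions in \<open>B\<close>; the \<open>2 ^ DIM('e)\<close> shifts are the colours.\<close>
definition grid :: "real \<Rightarrow> 'e::euclidean_space set \<Rightarrow> 'e set" where
  "grid s B = {x. \<forall>b\<in>Basis. (x \<bullet> b / s - (if b \<in> B then 1 else 0)) / 2 \<notin> \<int>}"

lemma open_grid: "s > 0 \<Longrightarrow> open (grid s B)"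
proof -
  assume "s > 0"
  have "open {x::'a. (x \<bullet> b / s - (if b \<in> B then 1 else 0)) / 2 \<notin> \<int>}" for b
  proof -
    have "open ((\<lambda>x::'a. (x \<bullet> b / s - (if b \<in> B then 1 else 0)) / 2) -` (- \<int>))"
      using \<open>s > 0\<close> by (intro open_vimage) (auto intro!: continuous_intros)
    then show ?thesis by (simp add: vimage_def)
  qed
  moreover have "grid s B = (\<Inter>b\<in>Basis. {x. (x \<bullet> b / s - (if b \<in> B then 1 else 0)) / 2 \<notin> \<int>})"
    unfolding grid_def by blast
  ultimately show ?thesis by auto
qed

text \<open>By the intermediate value theorem a coordinate cannot cross a wall of the grid on a
  connected set, so it varies by less than the distance \<open>2 * s\<close> between walls. Summing
  over the coordinates gives the factor \<open>DIM('e)\<close>.\<close>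

lemma connected_grid_diam:
  fixes D :: "'e::euclidean_space set"
  assumes "connected D" "D \<subseteq> grid s B" "s > 0" "x \<in> D" "y \<in> D"
  shows "dist x y \<le> 2 * s * DIM('e)"
proof -
  have lt: "v \<bullet> b - u \<bullet> b < 2 * s" if b: "b \<in> Basis" and "u \<in> D" "v \<in> D" for b u v
  proof (rule ccontr)
    assume big: "\<not> ?thesis"
    define \<beta> :: real where "\<beta> = (if b \<in> B then 1 else 0)"
    \<comment> \<open>\<open>?F\<close> takes integer values exactly on the walls orthogonal to
      \<open>b\<close>; a gap of \<open>2 * s\<close> raises it by 1, which forces an integer in
      between.\<close>
    let ?F = "\<lambda>z::'e. (z \<bullet> b / s - \<beta>) / 2"
    have "(v \<bullet> b - u \<bullet> b) / s \<ge> 2" using big assms(3) by (simp add: field_simps)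
    then have "?F v \<ge> ?F u + 1" by (simp add: diff_divide_distrib)
    then have "?F u \<le> of_int \<lceil>?F u\<rceil>" "of_int \<lceil>?F u\<rceil> \<le> ?F v" by linarith+
    moreover have "connected (?F ` D)"
      by (intro connected_continuous_image assms(1) continuous_intros) (use assms(3) in auto)
    ultimately have "of_int \<lceil>?F u\<rceil> \<in> ?F ` D"
      using connectedD_interval that(2,3) by blast
    then obtain z where "z \<in> D" "?F z = of_int \<lceil>?F u\<rceil>" by (metis (no_types, lifting) image_iff)
    then have "z \<in> D" "?F z \<in> \<int>" by auto
    then show False using assms(2) b by (auto simp: grid_def \<beta>_def)
  qed
  have "norm (x - y) \<le> (\<Sum>b\<in>Basis. \<bar>(x - y) \<bullet> b\<bar>)" by (rule norm_le_l1)
  also have "\<dots> \<le> (\<Sum>b\<in>(Basis::'e set). 2 * s)"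
    using lt assms(4,5) by (intro sum_mono) (auto simp: inner_diff_left abs_le_iff intro: less_imp_le)
  finally show ?thesis by (simp add: dist_norm mult.commute)
qed

text \<open>An interval shorter than \<open>s\<close> cannot meet both the even and the odd multiples of \<open>s\<close>.\<close>
lemma segment_subset_grid:
  fixes p q :: "'e::euclidean_space"
  assumes "s > 0" "dist p q < s"
  shows "\<exists>B\<subseteq>Basis. closed_segment p q \<subseteq> grid s B"
proof -
  \<comment> \<open>The shift is made in exactly those directions in which the segment meets an even
    multiple of \<open>s\<close>. There the walls move to the odd multiples, which it then
    misses.\<close>
  define B where "B = {b\<in>Basis. \<exists>z\<in>closed_segment p q. (z \<bullet> b / s) / 2 \<in> \<int>}"
  have "(z \<bullet> b / s - (if b \<in> B then 1 else 0)) / 2 \<notin> \<int>"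
    if z: "z \<in> closed_segment p q" and b: "b \<in> Basis" for z b
  proof (cases "b \<in> B")
    case False
    then show ?thesis using z b by (auto simp: B_def)
  next
    case True
    then obtain w where w: "w \<in> closed_segment p q" "(w \<bullet> b / s) / 2 \<in> \<int>" by (auto simp: B_def)
    obtain u v where uv: "0 \<le> u" "u \<le> 1" "0 \<le> v" "v \<le> 1" "z = (1 - u) *\<^sub>R p + u *\<^sub>R q"
      "w = (1 - v) *\<^sub>R p + v *\<^sub>R q" using z w(1) by (auto simp: closed_segment_def)
    have "z - w = (v - u) *\<^sub>R (p - q)" unfolding uv(5,6) by (simp add: algebra_simps)
    moreover have "\<bar>v - u\<bar> \<le> 1" using uv by linarith
    ultimately have "dist z w \<le> dist p q"
      by (simp add: dist_norm mult_left_le_one_le)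
    then have "norm (z - w) < s" using assms(2) by (simp add: dist_norm)
    then have zw: "\<bar>z \<bullet> b - w \<bullet> b\<bar> < s"
      using Basis_le_norm[OF b, of "z - w"] by (simp add: inner_diff_left)
    show ?thesis
    proof
      assume "(z \<bullet> b / s - (if b \<in> B then 1 else 0)) / 2 \<in> \<int>"
      then obtain m where "(z \<bullet> b / s - 1) / 2 = of_int m" using True by (auto elim: Ints_cases)
      moreover obtain n where "(w \<bullet> b / s) / 2 = of_int n" using w(2) by (auto elim: Ints_cases)
      ultimately have "z \<bullet> b = s * of_int (2 * m + 1)" "w \<bullet> b = s * of_int (2 * n)"
        using assms(1) by (simp_all add: field_simps)
      then have "z \<bullet> b - w \<bullet> b = s * of_int (2 * m + 1 - 2 * n)" by (simp add: algebra_simps)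
      then have "\<bar>z \<bullet> b - w \<bullet> b\<bar> = s * \<bar>of_int (2 * m + 1 - 2 * n)\<bar>"
        using assms(1) by (simp add: abs_mult)
      then have "\<bar>real_of_int (2 * m + 1 - 2 * n)\<bar> < 1" using zw assms(1) by (simp add: )
      then have "2 * m + 1 - 2 * n = 0" by linarith
      then show False by presburger
    qed
  qed
  then have "closed_segment p q \<subseteq> grid s B" unfolding grid_def by blast
  moreover have "B \<subseteq> Basis" by (auto simp: B_def)
  ultimately show ?thesis by blast
qed

section \<open>Transport of cells to the manifold through charts\<close>

text \<open>From dimension 2 on, a connected open set \<open>D\<close> admits homeomorphisms
  supported in \<open>D\<close> that move finitely many points at will. Carried over by the chart,
  such a map extends by the identity; \<open>closure D \<subseteq> V\<close> and boundedness keep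
  its support away from the edge of the chart domain.\<close>

lemma movable_chart_image:
  fixes \<phi> :: "'a::t2_space \<Rightarrow> 'e::euclidean_space"
  assumes hom: "homeomorphism U V \<phi> \<psi>" and "open U"
    and D: "open D" "connected D" "bounded D" "closure D \<subseteq> V" and dim: "DIM('e) \<ge> 2"
  shows "movable (\<psi> ` D)"
  unfolding movable_def
proof (intro allI impI)
  fix I :: "nat set" and x y :: "nat \<Rightarrow> 'a"
  assume I: "finite I" and xy: "x ` I \<subseteq> \<psi> ` D" "y ` I \<subseteq> \<psi> ` D" "inj_on x I" "inj_on y I"
  have DV: "D \<subseteq> V" using D(4) closure_subset by blast
  have \<psi>\<phi>: "\<psi> (\<phi> z) = z" if "z \<in> U" for z using hom that by (simp add: homeomorphism_def)
  have \<phi>\<psi>: "\<phi> (\<psi> z) = z" if "z \<in> V" for z using hom that by (simp add: homeomorphism_def)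
  have \<psi>U: "\<psi> z \<in> U" if "z \<in> V" for z using hom that by (auto simp: homeomorphism_def)
  have \<phi>V: "\<phi> z \<in> V" if "z \<in> U" for z using hom that by (auto simp: homeomorphism_def)
  have xD: "\<phi> (x i) \<in> D" "x i \<in> U" and yD: "\<phi> (y i) \<in> D" "y i \<in> U" if "i \<in> I" for i
    using xy that DV \<phi>\<psi> \<psi>U by (smt (verit) image_iff image_subset_iff subset_iff)+
  have pw: "pairwise (\<lambda>i j. \<phi> (x i) \<noteq> \<phi> (x j) \<and> \<phi> (y i) \<noteq> \<phi> (y j)) I"
    using xy(3,4) xD(2) yD(2) \<psi>\<phi> unfolding pairwise_def inj_on_def by metis
  obtain F F' where F: "homeomorphism UNIV UNIV F F'" "\<And>i. i \<in> I \<Longrightarrow> F (\<phi> (x i)) = \<phi> (y i)"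
      "{z. \<not> (F z = z \<and> F' z = z)} \<subseteq> D"
  \<comment> \<open>With nothing to move, \<open>D\<close> may be empty. Otherwise its affine hull
    is the whole space, as the result on moving points asks for.\<close>
  proof (cases "I = {}")
    case True
    then show ?thesis using that[of id id] by (auto simp: homeomorphism_def)
  next
    case False
    then have "D \<noteq> {}" using xD by auto
    then have aff: "affine hull D = UNIV" using affine_hull_open D(1) by blast
    obtain g g' where "homeomorphism UNIV UNIV g g'" "\<And>i. i \<in> I \<Longrightarrow> g (\<phi> (x i)) = \<phi> (y i)"
      "{z. \<not> (g z = z \<and> g' z = z)} \<subseteq> D"
      by (rule homeomorphism_moving_points_exists[of D UNIV I "\<lambda>i. \<phi> (x i)" "\<lambda>i. \<phi> (y i)"])
        (simp_all add: dim D I xD yD pw aff)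
    then show ?thesis by (rule that)
  qed
  define ext where "ext = (\<lambda>g z. if z \<in> U then \<psi> (g (\<phi> z)) else z)"
  have FD: "g z \<in> D \<longleftrightarrow> z \<in> D" if "g = F \<or> g = F'" for g z
    using that F(1,3) unfolding homeomorphism_def by (smt (verit) UNIV_I mem_Collect_eq subsetD)
  have FV: "g z \<in> V" if "g = F \<or> g = F'" "z \<in> V" for g z
    using FD that F(3) DV by (metis (mono_tags, lifting) mem_Collect_eq subsetD)
  have fixed: "ext g z = z" if "g = F \<or> g = F'" "z \<notin> \<psi> ` D" for g z
  proof (cases "z \<in> U")
    case True
    then have "\<phi> z \<notin> D" using that(2) \<psi>\<phi> by (metis image_eqI)
    then have "g (\<phi> z) = \<phi> z" using that(1) F(3) by blast
    then show ?thesis using True \<psi>\<phi> by (simp add: ext_def)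
  qed (simp add: ext_def)
  have cont: "continuous_on UNIV (ext g)" if g: "g = F \<or> g = F'" for g
  proof -
    have "continuous_on UNIV g" using g F(1) by (auto simp: homeomorphism_def)
    then have "continuous_on U (\<lambda>z. \<psi> (g (\<phi> z)))"
      using hom FV[OF g] unfolding homeomorphism_def
      by (intro continuous_on_compose2[of V \<psi> U "\<lambda>z. g (\<phi> z)"] continuous_on_compose2[of UNIV g U \<phi>]) auto
    then have 1: "continuous_on U (ext g)" by (simp add: ext_def cong: continuous_on_cong)
    \<comment> \<open>The image of \<open>closure D\<close> is compact, hence closed in
      \<open>M\<close>. Its complement and \<open>U\<close> are two open sets that cover
      \<open>M\<close>, and \<open>ext g\<close> is continuous on each.\<close>
    have "compact (\<psi> ` closure D)"
      using D(3,4) hom by (intro compact_continuous_image) (auto simp: homeomorphism_def compact_closure elim: continuous_on_subset)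
    then have op: "open (- (\<psi> ` closure D))" by (simp add: compact_imp_closed open_Compl)
    have "ext g z = z" if "z \<in> - (\<psi> ` closure D)" for z
      using fixed[OF g, of z] that closure_subset by blast
    then have 2: "continuous_on (- (\<psi> ` closure D)) (ext g)"
      using continuous_on_eq[OF continuous_on_id] by metis
    have "U \<union> - (\<psi> ` closure D) = UNIV" using D(4) \<psi>U by auto
    then show ?thesis using continuous_on_open_Un[OF assms(2) op 1 2] by simp
  qed
  have inv: "ext g (ext g' z) = z" if "(g = F \<and> g' = F') \<or> (g = F' \<and> g' = F)" for g g' z
  proof (cases "z \<in> U")
    case True
    then have "g' (\<phi> z) \<in> V" using FV \<phi>V that by blast
    moreover have "g (g' w) = w" for w using that F(1) by (auto simp: homeomorphism_def)
    ultimately show ?thesis using True \<psi>\<phi> \<phi>\<psi> \<psi>U by (simp add: ext_def)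
  qed (simp add: ext_def)
  have "homeomorphism UNIV UNIV (ext F) (ext F')"
    using cont inv by (intro homeomorphismI) auto
  moreover have "ext F (x i) = y i" if "i \<in> I" for i
    using F(2)[OF that] xD(2)[OF that] yD(2)[OF that] \<psi>\<phi> by (simp add: ext_def)
  ultimately show "\<exists>h k. homeomorphism UNIV UNIV h k \<and> (\<forall>i\<in>I. h (x i) = y i) \<and> (\<forall>z. z \<notin> \<psi> ` D \<longrightarrow> h z = z)"
    using fixed by blast
qed

lemma atlas_chartE:
  assumes "smooth_atlas A"
  obtains c where "c \<in> A" "x \<in> fst c" "open (fst c)" "open (snd c ` fst c)"
    "homeomorphism (fst c) (snd c ` fst c) (snd c) (chart_inv c)"
proof -
  have "x \<in> (\<Union>c\<in>A. fst c)" using assms unfolding smooth_atlas_def by simp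
  then obtain c where "c \<in> A" "x \<in> fst c" by blast
  then show ?thesis using assms that unfolding smooth_atlas_def by blast
qed

lemma open_chart_image:
  fixes A :: "('a::topological_space, 'e::euclidean_space) chart set"
  assumes "smooth_atlas A" "c \<in> A" "open O'"
  shows "open (snd c ` (fst c \<inter> O'))"
proof -
  have c: "open (fst c)" "open (snd c ` fst c)" "homeomorphism (fst c) (snd c ` fst c) (snd c) (chart_inv c)"
    using assms unfolding smooth_atlas_def by blast+
  have "openin (top_of_set (snd c ` fst c)) (snd c ` (fst c \<inter> O'))"
    using homeomorphism_imp_open_map[OF c(3)] assms(3) by (simp add: openin_open_Int)
  then show ?thesis using c(2) openin_open_eq by blast
qed

text \<open>The part of a ball inside a chart has a nonempty open image, which is infinite because
  the dimension is at least 1. This leaves room for the auxiliary points and excludes a one-point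
  \<open>M\<close>.\<close>

lemma infinite_ball_manifold:
  fixes A :: "('a::metric_space, 'e::euclidean_space) chart set"
  assumes "smooth_atlas A" "e > 0"
  shows "infinite (ball (a::'a) e)"
proof
  assume fin: "finite (ball a e)"
  obtain c where c: "c \<in> A" "a \<in> fst c" using atlas_chartE[OF assms(1)] by metis
  have "open (snd c ` (fst c \<inter> ball a e))" using open_chart_image[OF assms(1) c(1)] by simp
  moreover have "finite (snd c ` (fst c \<inter> ball a e))" using fin by auto
  moreover have "snd c ` (fst c \<inter> ball a e) \<noteq> {}" using c(2) assms(2) by auto
  ultimately show False using finite_imp_not_open by blast
qed

text \<open>\<open>K\<close> is fixed before \<open>\<eta>\<close>, so only the mesh
  \<open>s\<close> depends on \<open>\<eta>\<close>. Uniform continuity of the inverse charts turns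
  a small mesh into small cells on \<open>M\<close>, that of the charts turns closeness on
  \<open>M\<close> into a coordinate distance below \<open>s\<close>, and a Lebesgue number places
  two close points in one chart ball.\<close>

lemma manifold_cells:
  fixes A :: "('a::metric_space, 'e::euclidean_space) chart set"
  assumes atlas: "smooth_atlas A" and comp: "compact (UNIV :: 'a set)" and dim: "DIM('e) \<ge> 2"
  shows "\<exists>K::('a \<times> 'e set) set. finite K \<and> (\<forall>\<eta>>0. \<exists>\<Q> :: 'a \<times> 'e set \<Rightarrow> 'a set set. \<exists>\<delta>>0.
     (\<forall>c\<in>K. disjoint (\<Q> c)) \<and>
     (\<forall>c\<in>K. \<forall>Q\<in>\<Q> c. movable Q \<and> (\<forall>a\<in>Q. \<forall>b\<in>Q. dist a b \<le> \<eta>)) \<and>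
     (\<forall>a b. dist a b < \<delta> \<longrightarrow> (\<exists>c\<in>K. \<exists>Q\<in>\<Q> c. a \<in> Q \<and> b \<in> Q)))"
proof -
  define P where "P = (\<lambda>x (c::('a, 'e) chart) r. x \<in> fst c \<and> open (fst c) \<and>
      homeomorphism (fst c) (snd c ` fst c) (snd c) (chart_inv c) \<and> r > 0 \<and>
      cball (snd c x) r \<subseteq> snd c ` fst c)"
  have "\<exists>c r. P x c r" for x
  proof -
    obtain c where c: "c \<in> A" "x \<in> fst c" "open (fst c)" "open (snd c ` fst c)"
      "homeomorphism (fst c) (snd c ` fst c) (snd c) (chart_inv c)" using atlas_chartE[OF atlas] .
    moreover obtain r where "r > 0" "cball (snd c x) r \<subseteq> snd c ` fst c"
      using c(2,4) open_contains_cball by blast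
    ultimately show ?thesis unfolding P_def by blast
  qed
  then obtain c r where "\<And>x. P x (c x) (r x)" by metis
  then have cr: "\<And>x. x \<in> fst (c x)" "\<And>x. open (fst (c x))"
      "\<And>x. homeomorphism (fst (c x)) (snd (c x) ` fst (c x)) (snd (c x)) (chart_inv (c x))"
      "\<And>x. r x > 0" "\<And>x. cball (snd (c x) x) (r x) \<subseteq> snd (c x) ` fst (c x)"
    unfolding P_def by blast+
  define \<phi> where "\<phi> = (\<lambda>x. snd (c x))"
  define \<psi> where "\<psi> = (\<lambda>x. chart_inv (c x))"
  define b where "b = (\<lambda>x. ball (\<phi> x x) (r x))"
  \<comment> \<open>Cells lie in the open balls \<open>b x\<close>; the closed balls
    \<open>C x\<close> and their images are compact, so both the chart and its inverse are uniformly
    continuous there.\<close>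
  define C where "C = (\<lambda>x. cball (\<phi> x x) (r x))"
  define U where "U = (\<lambda>x. fst (c x))"
  define V where "V = (\<lambda>x. \<phi> x ` U x)"
  have hom: "homeomorphism (U x) (V x) (\<phi> x) (\<psi> x)" for x
    using cr(3) by (simp add: U_def V_def \<phi>_def \<psi>_def)
  have bC: "b x \<subseteq> C x" and CV: "C x \<subseteq> V x" for x
    using cr(5) by (auto simp: b_def C_def V_def U_def \<phi>_def)
  have \<psi>\<phi>: "\<psi> x (\<phi> x z) = z" if "z \<in> U x" for x z using hom that by (simp add: homeomorphism_def)
  have \<phi>\<psi>: "\<phi> x (\<psi> x z) = z" if "z \<in> V x" for x z using hom that by (simp add: homeomorphism_def)
  have \<psi>cont: "continuous_on (C x) (\<psi> x)" for x
    using hom CV by (meson continuous_on_subset homeomorphism_cont2)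
  have compC: "compact (\<psi> x ` C x)" for x
    using \<psi>cont by (intro compact_continuous_image) (auto simp: C_def)
  have \<psi>CU: "\<psi> x ` C x \<subseteq> U x" for x
    using hom CV by (metis homeomorphism_image2 image_mono)
  have \<phi>cont: "continuous_on (\<psi> x ` C x) (\<phi> x)" for x
    using hom \<psi>CU by (meson continuous_on_subset homeomorphism_cont1)
  define W where "W = (\<lambda>x. \<psi> x ` b x)"
  have openW: "open (W x)" for x
  proof -
    have "openin (top_of_set (V x)) (b x)"
      using subset_trans[OF bC CV] by (intro open_subset) (auto simp: b_def)
    moreover have "homeomorphism (V x) (U x) (\<psi> x) (\<phi> x)" using hom homeomorphism_sym by blast
    ultimately have "openin (top_of_set (U x)) (W x)"
      unfolding W_def by (rule homeomorphism_imp_open_map[rotated])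
    then show ?thesis using cr(2) openin_open_eq by (auto simp: U_def)
  qed
  have xW: "x \<in> W x" for x
  proof -
    have "\<psi> x (\<phi> x x) = x" using \<psi>\<phi>[of x x] cr(1) by (simp add: U_def)
    moreover have "\<phi> x x \<in> b x" using cr(4) by (simp add: b_def)
    ultimately show ?thesis unfolding W_def by (metis imageI)
  qed
  obtain J where J: "finite J" "UNIV \<subseteq> (\<Union>x\<in>J. W x)"
  proof (rule compactE_image[OF comp, of UNIV W])
    show "open (W x)" for x by (rule openW)
    show "UNIV \<subseteq> (\<Union>x. W x)" using xW by blast
  qed
  define K where "K = J \<times> Pow (Basis :: 'e set)"
  have "finite K" using J by (simp add: K_def)
  moreover have "\<exists>\<Q> :: 'a \<times> 'e set \<Rightarrow> 'a set set. \<exists>\<delta>>0.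
     (\<forall>c\<in>K. disjoint (\<Q> c)) \<and>
     (\<forall>c\<in>K. \<forall>Q\<in>\<Q> c. movable Q \<and> (\<forall>a\<in>Q. \<forall>b\<in>Q. dist a b \<le> \<eta>)) \<and>
     (\<forall>a b. dist a b < \<delta> \<longrightarrow> (\<exists>c\<in>K. \<exists>Q\<in>\<Q> c. a \<in> Q \<and> b \<in> Q))" if "\<eta> > 0" for \<eta>
  proof -
    have "\<exists>e>0. \<forall>u\<in>C x. \<forall>v\<in>C x. dist v u < e \<longrightarrow> dist (\<psi> x v) (\<psi> x u) < \<eta>" for x
      using compact_uniformly_continuous[OF \<psi>cont] that
      unfolding uniformly_continuous_on_def C_def by (metis compact_cball)
    then obtain e where e: "\<And>x. e x > 0"
      "\<And>x u v. u \<in> C x \<Longrightarrow> v \<in> C x \<Longrightarrow> dist v u < e x \<Longrightarrow> dist (\<psi> x v) (\<psi> x u) < \<eta>"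
      by metis
    \<comment> \<open>A cell has coordinate diameter at most \<open>2 * s * DIM('e)\<close>, which
      this choice puts below every \<open>e x\<close>. Inserting 1 makes \<open>Min\<close>
      meaningful for any finite \<open>J\<close>.\<close>
    define s where "s = Min (insert 1 (e ` J)) / (2 * DIM('e) + 1)"
    have "Min (insert 1 (e ` J)) > 0" using J e by (subst Min_gr_iff) auto
    then have s: "s > 0" by (simp add: s_def)
    have se: "2 * s * DIM('e) < e x" if "x \<in> J" for x
    proof -
      have "s * (2 * DIM('e) + 1) = Min (insert 1 (e ` J))" by (simp add: s_def)
      also have "\<dots> \<le> e x" using J that by (intro Min_le) auto
      finally show ?thesis using s by (simp add: algebra_simps)
    qed
    have "\<exists>d>0. \<forall>u\<in>\<psi> x ` C x. \<forall>v\<in>\<psi> x ` C x. dist v u < d \<longrightarrow> dist (\<phi> x v) (\<phi> x u) < s" for x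
      using compact_uniformly_continuous[OF \<phi>cont compC] s
      unfolding uniformly_continuous_on_def by metis
    then obtain d where d: "\<And>x. d x > 0"
      "\<And>x u v. u \<in> \<psi> x ` C x \<Longrightarrow> v \<in> \<psi> x ` C x \<Longrightarrow> dist v u < d x \<Longrightarrow> dist (\<phi> x v) (\<phi> x u) < s"
      by metis
    obtain \<delta>0 where \<delta>0: "\<delta>0 > 0" "\<And>x. \<exists>G\<in>W ` J. ball x \<delta>0 \<subseteq> G"
      using Heine_Borel_lemma[OF comp, of "W ` J"] J(2) openW by (metis UNIV_I imageE)
    define \<delta> where "\<delta> = Min (insert \<delta>0 (d ` J))"
    have \<delta>: "\<delta> > 0" "\<delta> \<le> \<delta>0" "\<And>x. x \<in> J \<Longrightarrow> \<delta> \<le> d x"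
      using J d \<delta>0 by (auto simp: \<delta>_def)
    \<comment> \<open>Components are taken after intersecting with the ball, so that the cells near
      its boundary are still connected and open.\<close>
    define \<Q> where "\<Q> = (\<lambda>(x, B). (`) (\<psi> x) ` components (b x \<inter> grid s B))"
    have Db: "D \<subseteq> b x" "D \<subseteq> grid s B" if "D \<in> components (b x \<inter> grid s B)" for D x B
      using in_components_subset[OF that] by auto
    have "disjoint (\<Q> k)" for k
    proof -
      obtain x B where k: "k = (x, B)" by (cases k)
      have "P = P'" if PP: "P \<in> \<Q> k" "P' \<in> \<Q> k" "z \<in> P" "z \<in> P'" for P P' z
      proof -
        obtain D D' where D: "D \<in> components (b x \<inter> grid s B)" "P = \<psi> x ` D"
          "D' \<in> components (b x \<inter> grid s B)" "P' = \<psi> x ` D'"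
          using PP(1,2) by (auto simp: \<Q>_def k)
        obtain u u' where u: "u \<in> D" "u' \<in> D'" "z = \<psi> x u" "z = \<psi> x u'" using PP D by auto
        then have "u = u'" using \<phi>\<psi>[of u x] \<phi>\<psi>[of u' x] Db[OF D(1)] Db[OF D(3)] bC CV
          by (metis subsetD)
        then have "D = D'" using components_nonoverlap[OF D(1,3)] u by auto
        then show ?thesis using D by simp
      qed
      then show ?thesis by (auto simp: disjoint_def)
    qed
    moreover have "movable Q \<and> (\<forall>a\<in>Q. \<forall>b\<in>Q. dist a b \<le> \<eta>)" if kQ: "k \<in> K" "Q \<in> \<Q> k" for k Q
    proof -
      obtain x B D where D: "k = (x, B)" "D \<in> components (b x \<inter> grid s B)" "Q = \<psi> x ` D"
        using kQ(2) by (cases k) (auto simp: \<Q>_def)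
      have x: "x \<in> J" using kQ(1) D(1) by (simp add: K_def)
      have con: "connected D" using D(2) in_components_connected by blast
      have "open D"
        using open_components[OF _ D(2)] open_grid[OF s] by (auto simp: b_def)
      moreover have DC: "closure D \<subseteq> C x"
        using Db(1)[OF D(2)] bC[of x] closure_minimal[of D "C x"] by (auto simp: C_def)
      moreover have "bounded D"
        using Db(1)[OF D(2)] bounded_subset[OF bounded_ball] by (auto simp: b_def)
      ultimately have "movable Q"
        unfolding D(3) using movable_chart_image[OF hom, of x D] con cr(2) CV dim by (auto simp: U_def)
      moreover have "dist (\<psi> x v) (\<psi> x u) \<le> \<eta>" if "u \<in> D" "v \<in> D" for u v
      proof -
        have "dist v u < e x"
          using connected_grid_diam[OF con Db(2)[OF D(2)] s that(2,1)] se[OF x] by linarith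
        then show ?thesis using e(2)[of u x v] that DC closure_subset by (meson less_imp_le subsetD)
      qed
      ultimately show ?thesis by (auto simp: D(3))
    qed
    moreover have "\<exists>k\<in>K. \<exists>Q\<in>\<Q> k. a \<in> Q \<and> a' \<in> Q" if aa: "dist a a' < \<delta>" for a a'
    proof -
      obtain x where x: "x \<in> J" "ball a \<delta>0 \<subseteq> W x" using \<delta>0(2) by blast
      have "a \<in> ball a \<delta>0" "a' \<in> ball a \<delta>0" using aa \<delta>(2) \<delta>0(1) by auto
      then obtain u u' where u: "u \<in> b x" "u' \<in> b x" "a = \<psi> x u" "a' = \<psi> x u'"
        using x(2) unfolding W_def by (metis imageE subsetD)
      have "dist a a' < d x" using aa \<delta>(3)[OF x(1)] by simp
      then have "dist (\<phi> x a) (\<phi> x a') < s" using d(2)[of a' x a] u bC by auto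
      then have "dist u u' < s" using u \<phi>\<psi> bC CV by (metis subsetD)
      then obtain B where B: "B \<subseteq> Basis" "closed_segment u u' \<subseteq> grid s B"
        using segment_subset_grid[OF s] by blast
      \<comment> \<open>The ball is convex. Thus the segment is a connected subset of the ball that
        avoids all walls, and both of its ends lie in a single cell.\<close>
      moreover have "closed_segment u u' \<subseteq> b x"
        using u(1,2) by (simp add: b_def closed_segment_subset)
      ultimately obtain D where D: "D \<in> components (b x \<inter> grid s B)" "closed_segment u u' \<subseteq> D"
        using exists_component_superset[of "closed_segment u u'" "b x \<inter> grid s B"]
        by (metis Int_subset_iff connected_segment(1) ends_in_segment(1) empty_iff subset_empty)
      have "(x, B) \<in> K" using x B by (simp add: K_def)
      moreover have "\<psi> x ` D \<in> \<Q> (x, B)" using D by (simp add: \<Q>_def)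
      moreover have "a \<in> \<psi> x ` D" "a' \<in> \<psi> x ` D" using u D(2) by auto
      ultimately show ?thesis by blast
    qed
    ultimately show ?thesis using \<delta>(1) by blast
  qed
  ultimately show ?thesis by blast
qed

lemma manifold_move_points:
  fixes A :: "('a::metric_space, 'e::euclidean_space) chart set"
  assumes "smooth_atlas A" "compact (UNIV :: 'a set)" "DIM('e) \<ge> 2" "\<epsilon> > 0"
  shows "\<exists>\<delta>>0. \<forall>(I::nat set) (x::nat \<Rightarrow> 'a) y. finite I \<longrightarrow> inj_on x I \<longrightarrow> inj_on y I \<longrightarrow>
     (\<forall>i\<in>I. dist (x i) (y i) < \<delta>) \<longrightarrow>
     (\<exists>h k. homeomorphism UNIV UNIV h k \<and> (\<forall>i\<in>I. h (x i) = y i) \<and> (\<forall>z. dist z (h z) \<le> \<epsilon>))"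
proof -
  obtain K :: "('a \<times> 'e set) set" where K: "finite K"
    "\<forall>\<eta>>0. \<exists>\<Q> :: 'a \<times> 'e set \<Rightarrow> 'a set set. \<exists>\<delta>>0.
     (\<forall>c\<in>K. disjoint (\<Q> c)) \<and>
     (\<forall>c\<in>K. \<forall>Q\<in>\<Q> c. movable Q \<and> (\<forall>a\<in>Q. \<forall>b\<in>Q. dist a b \<le> \<eta>)) \<and>
     (\<forall>a b. dist a b < \<delta> \<longrightarrow> (\<exists>c\<in>K. \<exists>Q\<in>\<Q> c. a \<in> Q \<and> b \<in> Q))"
    using manifold_cells[OF assms(1-3)] by (elim exE conjE)
  \<comment> \<open>Two passes over the colours cost \<open>2 * real (card K) * \<eta>\<close>; the
    \<open>+ 1\<close> keeps the denominator positive.\<close>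
  define \<eta> where "\<eta> = \<epsilon> / (2 * real (card K) + 1)"
  have \<eta>: "\<eta> > 0" using assms(4) by (simp add: \<eta>_def add_nonneg_pos)
  have "\<eta> * (2 * real (card K) + 1) = \<epsilon>" by (simp add: \<eta>_def add_nonneg_pos)
  then have \<eta>\<epsilon>: "2 * real (card K) * \<eta> \<le> \<epsilon>" using \<eta> by (simp add: algebra_simps)
  obtain \<Q> :: "'a \<times> 'e set \<Rightarrow> 'a set set" and \<delta> where Q: "\<delta> > 0"
     "\<forall>c\<in>K. disjoint (\<Q> c)"
     "\<forall>c\<in>K. \<forall>Q\<in>\<Q> c. movable Q \<and> (\<forall>a\<in>Q. \<forall>b\<in>Q. dist a b \<le> \<eta>)"
     "\<forall>a b. dist a b < \<delta> \<longrightarrow> (\<exists>c\<in>K. \<exists>Q\<in>\<Q> c. a \<in> Q \<and> b \<in> Q)"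
    using K(2)[rule_format, OF \<eta>] by (elim exE conjE)
  show ?thesis
  proof (intro exI[of _ \<delta>] conjI allI impI Q(1))
    fix I :: "nat set" and x y :: "nat \<Rightarrow> 'a"
    assume I: "finite I" "inj_on x I" "inj_on y I" "\<forall>i\<in>I. dist (x i) (y i) < \<delta>"
    have "\<exists>h k. homeomorphism UNIV UNIV h k \<and> (\<forall>i\<in>I. h (x i) = y i) \<and>
           (\<forall>z. dist z (h z) \<le> 2 * real (card K) * \<eta>)"
    proof (rule move_points_small[where \<Q> = \<Q> and \<delta> = \<delta>])
      show "\<And>a b. dist a b < \<delta> \<Longrightarrow> \<exists>c\<in>K. \<exists>Q\<in>\<Q> c. a \<in> Q \<and> b \<in> Q"
        using Q(4) by (elim allE impE)
    qed (simp_all add: K(1) I Q(2,3) less_imp_le[OF \<eta>] infinite_ball_manifold[OF assms(1)])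
    then show "\<exists>h k. homeomorphism UNIV UNIV h k \<and> (\<forall>i\<in>I. h (x i) = y i) \<and> (\<forall>z. dist z (h z) \<le> \<epsilon>)"
      using \<eta>\<epsilon> order_trans by blast
  qed
qed

section \<open>Closing pseudo-orbits\<close>

text \<open>A repeated point would allow the loop between its two visits to be cut out, leaving a
  shorter cycle through \<open>x\<close>.\<close>

lemma minimal_pseudo_cycle:
  fixes f :: "'a::metric_space \<Rightarrow> 'a"
  assumes "r \<ge> 1" "z 0 = x" "z r = x" "\<And>i. i < r \<Longrightarrow> dist (f (z i)) (z (Suc i)) < \<delta>"
  shows "\<exists>r z. r \<ge> 1 \<and> z 0 = x \<and> z r = x \<and> (\<forall>i<r. dist (f (z i)) (z (Suc i)) < \<delta>) \<and> inj_on z {..<r}"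
proof -
  define P where "P = (\<lambda>r. r \<ge> 1 \<and> (\<exists>z. z 0 = x \<and> z r = x \<and> (\<forall>i<r. dist (f (z i)) (z (Suc i)) < \<delta>)))"
  define r0 where "r0 = (LEAST r. P r)"
  have "P r" using assms unfolding P_def by blast
  then have "P r0" unfolding r0_def by (rule LeastI)
  then obtain w where w: "r0 \<ge> 1" "w 0 = x" "w r0 = x" "\<And>i. i < r0 \<Longrightarrow> dist (f (w i)) (w (Suc i)) < \<delta>"
    unfolding P_def by blast
  have no: "w i \<noteq> w j" if ij: "i < j" "j < r0" for i j
  proof
    assume eq: "w i = w j"
    \<comment> \<open>The terms after \<open>i\<close> up to \<open>j\<close> are skipped. The jump
      out of position \<open>i\<close> is the old one out of \<open>j\<close>, since
      \<open>w i = w j\<close>; as \<open>j < r0\<close>, the last point is still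
      \<open>w r0\<close>.\<close>
    define v where "v = (\<lambda>k. if k \<le> i then w k else w (k + (j - i)))"
    have "dist (f (v k)) (v (Suc k)) < \<delta>" if k: "k < r0 - (j - i)" for k
    proof (cases "k = i")
      case True
      then show ?thesis using w(4)[OF ij(2)] ij eq by (simp add: v_def)
    next
      case False
      then show ?thesis using w(4)[of k] w(4)[of "k + (j - i)"] k ij by (auto simp: v_def)
    qed
    moreover have "v 0 = x" "v (r0 - (j - i)) = x" using w(2,3) ij by (auto simp: v_def)
    moreover have "r0 - (j - i) \<ge> 1" using ij by simp
    ultimately have "P (r0 - (j - i))" unfolding P_def by blast
    then have "r0 \<le> r0 - (j - i)" unfolding r0_def by (rule Least_le)
    then show False using ij by simp
  qed
  have "inj_on w {..<r0}"
    by (rule linorder_inj_onI') (use no in auto)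
  then show ?thesis using w by blast
qed

text \<open>The map \<open>h\<close> has to send each \<open>f (w i)\<close> to
  \<open>w (Suc i)\<close>. The sources are distinct because \<open>f\<close> is injective, the
  targets because they are the points \<open>w i\<close> shifted cyclically by one.\<close>

lemma homeomorphism_closing:
  fixes f :: "'a::metric_space \<Rightarrow> 'a"
  assumes move: "\<And>(I::nat set) (x::nat \<Rightarrow> 'a) y. finite I \<Longrightarrow> inj_on x I \<Longrightarrow> inj_on y I \<Longrightarrow>
     (\<And>i. i \<in> I \<Longrightarrow> dist (x i) (y i) < \<delta>) \<Longrightarrow>
     \<exists>h k. homeomorphism UNIV UNIV h k \<and> (\<forall>i\<in>I. h (x i) = y i) \<and> (\<forall>z. dist z (h z) \<le> \<epsilon>)"
    and f: "homeomorphism UNIV UNIV f f'"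
    and cyc: "r \<ge> 1" "z 0 = x" "z r = x" "\<And>i. i < r \<Longrightarrow> dist (f (z i)) (z (Suc i)) < \<delta>"
  shows "\<exists>g k n. homeomorphism UNIV UNIV g k \<and> (\<forall>y. dist (f y) (g y) \<le> \<epsilon>) \<and> n \<ge> 1 \<and> (g ^^ n) x = x"
proof -
  have "\<exists>r z. r \<ge> 1 \<and> z 0 = x \<and> z r = x \<and> (\<forall>i<r. dist (f (z i)) (z (Suc i)) < \<delta>) \<and> inj_on z {..<r}"
    using minimal_pseudo_cycle[OF cyc] .
  then obtain n w where w: "n \<ge> 1" "w 0 = x" "w n = x" "\<And>i. i < n \<Longrightarrow> dist (f (w i)) (w (Suc i)) < \<delta>"
    "inj_on w {..<n}" by blast
  have "inj f" using f by (metis UNIV_I homeomorphism_def injI)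
  then have "inj_on (\<lambda>i. f (w i)) {..<n}" using w(5) by (simp add: inj_on_def)
  moreover have "inj_on (\<lambda>i. w (Suc i)) {..<n}"
  proof (rule linorder_inj_onI')
    fix i j assume ij: "i \<in> {..<n}" "j \<in> {..<n}" "i < j"
    show "w (Suc i) \<noteq> w (Suc j)"
    proof (cases "Suc j < n")
      case True
      then show ?thesis using inj_onD[OF w(5), of "Suc i" "Suc j"] ij by auto
    \<comment> \<open>The last target is \<open>w n = w 0\<close>, whereas \<open>Suc i\<close> is
      positive and still below \<open>n\<close>.\<close>
    next
      case False
      then have "w (Suc j) = w 0" using ij w(2,3) by (metis Suc_lessI lessThan_iff)
      then show ?thesis using inj_onD[OF w(5), of "Suc i" 0] ij by auto
    qed
  qed
  ultimately have "\<exists>h k. homeomorphism UNIV UNIV h k \<and> (\<forall>i\<in>{..<n}. h (f (w i)) = w (Suc i)) \<and>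
      (\<forall>z. dist z (h z) \<le> \<epsilon>)"
    by (intro move) (use w(4) in auto)
  then obtain h k where h: "homeomorphism UNIV UNIV h k" "\<And>i. i < n \<Longrightarrow> h (f (w i)) = w (Suc i)"
      "\<And>z. dist z (h z) \<le> \<epsilon>" by blast
  have "((h \<circ> f) ^^ i) x = w i" if "i \<le> n" for i
    using that by (induction i) (use w(2) h(2) in auto)
  then have "((h \<circ> f) ^^ n) x = x" using w(3) by simp
  moreover have "homeomorphism UNIV UNIV (h \<circ> f) (f' \<circ> k)"
    using homeomorphism_compose[OF f h(1)] .
  moreover have "dist (f y) ((h \<circ> f) y) \<le> \<epsilon>" for y using h(3) by simp
  ultimately show ?thesis using w(1) by blast
qed

section \<open>From leaf chains to periodic leaves\<close>

lemma intrinsic_dist_mono: "S \<subseteq> T \<Longrightarrow> intrinsic_dist A G T x y \<le> intrinsic_dist A G S x y"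
  unfolding intrinsic_dist_def by (rule INF_superset_mono) auto

lemma tnorm_zero: "riemannian_metric A G \<Longrightarrow> tnorm G x 0 = 0"
  unfolding riemannian_metric_def tnorm_def bilinear_def by (simp add: linear_0)

lemma leaf_ball_self:
  fixes A :: "('a::metric_space, 'e::euclidean_space) chart set"
  assumes "riemannian_metric A G" "x \<in> F x" "\<delta> \<ge> 0"
  shows "x \<in> leaf_ball A G F \<delta> x"
proof -
  have "C1_curve_on A (\<lambda>_. x) 0 1"
    unfolding C1_curve_on_def by (auto intro!: exI[of _ "\<lambda>_. 0"] derivative_intros)
  then have "piecewise_C1_curve A (\<lambda>_. x)"
    unfolding piecewise_C1_curve_def by (intro exI[of _ 1] exI[of _ real]) auto
  moreover have "velocity A (\<lambda>_. x) t = 0" for t by (simp add: velocity_def)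
  then have "curve_length A G (\<lambda>_. x) = 0"
    using tnorm_zero[OF assms(1)] by (simp add: curve_length_def)
  ultimately have "intrinsic_dist A G (F x) x x \<le> 0"
    unfolding intrinsic_dist_def using assms(2) by (intro INF_lower2[of "\<lambda>_. x"]) auto
  then show ?thesis using assms(2,3) by (auto simp: leaf_ball_def intro: order_trans)
qed

text \<open>Distance along a leaf dominates distance in \<open>M\<close>, so a leaf ball lies in the
  metric ball of the same radius. One \<open>\<delta>\<close> comes from this ball and two from
  approaching it: \<open>infdist\<close> may not be attained, so the point \<open>w\<close> is only
  sought within \<open>2 * \<delta>\<close>.\<close>

lemma chain_imp_pseudo_cycle:
  fixes A :: "('a::metric_space, 'e::euclidean_space) chart set"
  assumes M: "closed_riemannian_manifold A G" and F: "\<And>x. x \<in> F x"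
    and "leaf_chain A G F f \<delta> x y" "\<delta> > 0"
  shows "\<exists>r z. r \<ge> 1 \<and> z 0 = x \<and> z r = y \<and> (\<forall>i<r. dist (f (z i)) (z (Suc i)) < 3 * \<delta>)"
proof -
  obtain r :: nat and z where z: "r \<ge> 1" "z 0 = x" "z r = y"
    "\<forall>i<r. infdist (f (z i)) (leaf_ball A G F \<delta> (z (i + 1))) \<le> \<delta>"
    using assms(3) unfolding leaf_chain_def by blast
  have "dist (f (z i)) (z (Suc i)) < 3 * \<delta>" if "i < r" for i
  proof -
    let ?B = "leaf_ball A G F \<delta> (z (Suc i))"
    \<comment> \<open>\<open>infdist\<close> to the empty set is 0 by convention; the chain
      condition carries information only because the ball contains its centre.\<close>
    have "?B \<noteq> {}"
      using leaf_ball_self[of A G "z (Suc i)" F \<delta>] M F assms(4)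
      by (auto simp: closed_riemannian_manifold_def)
    moreover have "infdist (f (z i)) ?B < 2 * \<delta>" using z(4) that assms(4) by fastforce
    ultimately obtain w where w: "w \<in> ?B" "dist (f (z i)) w < 2 * \<delta>"
      by (auto simp: infdist_notempty cINF_less_iff)
    have "ereal (dist (z (Suc i)) w) = intrinsic_dist A G UNIV (z (Suc i)) w"
      using M by (simp add: closed_riemannian_manifold_def)
    also have "\<dots> \<le> intrinsic_dist A G (F (z (Suc i))) (z (Suc i)) w"
      by (rule intrinsic_dist_mono) simp
    also have "\<dots> \<le> ereal \<delta>" using w(1) by (simp add: leaf_ball_def)
    finally have "dist (z (Suc i)) w \<le> \<delta>" by simp
    then show ?thesis
      using w(2) dist_triangle[of "f (z i)" "z (Suc i)" w] by (simp add: dist_commute)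
  qed
  then show ?thesis using z(1-3) by (intro exI[of _ r] exI[of _ z]) simp
qed

text \<open>A real supremum bounds its terms only over a set that is bounded above. Boundedness of
  \<open>M\<close> provides this for the inner suprema, and together with nonempty values for the
  outer one.\<close>

lemma C0_dist_id_upper:
  fixes H :: "'a::metric_space \<Rightarrow> 'a set"
  assumes "bounded (UNIV :: 'a set)" "C0_dist_id H \<le> \<epsilon>" "\<And>x. H x \<noteq> {}" "y \<in> H x"
  shows "dist y x \<le> \<epsilon>"
proof -
  obtain B where B: "\<And>a b :: 'a. dist a b \<le> B"
    using assms(1) by (auto simp: bounded_two_points)
  have "dist y x \<le> (SUP y\<in>H x. dist y x)"
    by (intro cSUP_upper assms(4) bdd_aboveI[of _ B]) (use B in auto)
  also have "\<dots> \<le> (SUP x. SUP y\<in>H x. dist y x)"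
  proof (rule cSUP_upper)
    show "bdd_above (range (\<lambda>x. SUP y\<in>H x. dist y x))"
      using B assms(3) by (intro bdd_aboveI2[of _ _ B] cSUP_least) auto
  qed simp
  finally show ?thesis using assms(2) by (simp add: C0_dist_id_def)
qed

lemma stable_closing:
  fixes A :: "('a::metric_space, 'e::euclidean_space) chart set"
  assumes bd: "bounded (UNIV :: 'a set)"
    and F: "\<And>x. x \<in> F x" "\<And>x y. y \<in> F x \<Longrightarrow> F y = F x" and inv: "\<And>x. f ` F x = F (f x)"
    and stable: "topologically_stable_wrt A G F f"
    and closing: "\<And>\<delta>. \<delta> > 0 \<Longrightarrow>
      \<exists>g k n. homeomorphism UNIV UNIV g k \<and> (\<forall>y. dist (f y) (g y) \<le> \<delta>) \<and> n \<ge> 1 \<and> (g ^^ n) x = x"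
  shows "x \<in> closure (center_periodic F f)"
  unfolding closure_approachable
proof (intro allI impI)
  fix \<epsilon> :: real assume "\<epsilon> > 0"
  \<comment> \<open>Halving turns the weak inequality of stability into the strict one of the
    closure.\<close>
  then have "\<epsilon>/2 > 0" by simp
  then obtain \<delta> where \<delta>: "\<delta> > 0" "\<And>g. homeomorphism UNIV UNIV g (inv g) \<Longrightarrow> C0_dist f g \<le> \<delta> \<Longrightarrow>
        (\<exists>H. set_valued_map H \<and> compact_valued H \<and> continuous_wrt A G F (\<epsilon>/2) H \<and>
             C0_dist_id H \<le> \<epsilon>/2 \<and>
             (\<forall>x. f ` H x \<subseteq> (\<Union>y \<in> H (g x). leaf_ball A G F (\<epsilon>/2) y)))"
    using stable unfolding topologically_stable_wrt_def by blast
  obtain g k n where g: "homeomorphism UNIV UNIV g k" "\<And>y. dist (f y) (g y) \<le> \<delta>" "n \<ge> 1" "(g ^^ n) x = x"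
    using closing[OF \<delta>(1)] by blast
  have "inv g = k" using g(1) unfolding homeomorphism_def by (metis UNIV_I inv_equality)
  then have "homeomorphism UNIV UNIV g (inv g)" using g(1) by simp
  moreover have "C0_dist f g \<le> \<delta>" unfolding C0_dist_def by (rule cSUP_least) (use g(2) in auto)
  ultimately obtain H where H: "set_valued_map H" "continuous_wrt A G F (\<epsilon>/2) H" "C0_dist_id H \<le> \<epsilon>/2"
    "\<And>x. f ` H x \<subseteq> (\<Union>y \<in> H (g x). leaf_ball A G F (\<epsilon>/2) y)"
    using \<delta>(2) by blast
  obtain y0 where y0: "y0 \<in> H x" using H(1) by (auto simp: set_valued_map_def)
  \<comment> \<open>Only the leaf is followed, not the point: \<open>f\<close> maps leaves onto
    leaves, so replacing the orbit point by another one of its leaf loses nothing.\<close>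
  have orbit: "\<exists>y\<in>H ((g ^^ i) x). F ((f ^^ i) y0) = F y" for i
  proof (induction i)
    case (Suc i)
    then obtain y where y: "y \<in> H ((g ^^ i) x)" "F ((f ^^ i) y0) = F y" by blast
    then obtain y' where y': "y' \<in> H (g ((g ^^ i) x))" "f y \<in> leaf_ball A G F (\<epsilon>/2) y'"
      using H(4) by blast
    have "F ((f ^^ Suc i) y0) = f ` F ((f ^^ i) y0)" by (simp add: inv)
    also have "\<dots> = F (f y)" by (simp add: y(2) inv)
    also have "\<dots> = F y'" using y'(2) F(2) by (simp add: leaf_ball_def)
    finally show ?case using y'(1) by auto
  qed (use y0 in auto)
  obtain y where y: "y \<in> H x" "F ((f ^^ n) y0) = F y" using orbit[of n] g(4) by auto
  \<comment> \<open>The return point \<open>y\<close> may differ from \<open>y0\<close>, but all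
    points of \<open>H x\<close> share one leaf.\<close>
  have "y \<in> leaf_ball A G F (\<epsilon>/2) y0"
    using H(2) y(1) y0 unfolding continuous_wrt_def leaf_valued_def by blast
  then have "F y = F y0" using F(2) by (simp add: leaf_ball_def)
  then have "y0 \<in> center_periodic F f" using y(2) g(3) by (auto simp: center_periodic_def)
  moreover have "dist y0 x \<le> \<epsilon>/2"
    using C0_dist_id_upper[OF bd H(3) _ y0] H(1) by (simp add: set_valued_map_def)
  ultimately show "\<exists>y\<in>center_periodic F f. dist y x < \<epsilon>" using \<open>\<epsilon> > 0\<close> by force
qed

text \<open>An open set around \<open>x\<close> contains a center periodic point; if saturated, it
  contains the whole leaf to which that point returns.\<close>

lemma closure_periodic_subset_nonwandering:
  assumes F: "\<And>x. x \<in> F x"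
  shows "closure (center_periodic F f) \<subseteq> center_nonwandering F f"
proof
  fix x assume x: "x \<in> closure (center_periodic F f)"
  show "x \<in> center_nonwandering F f"
    unfolding center_nonwandering_def
  proof (intro CollectI allI impI)
    fix U assume U: "open U" "x \<in> U" "saturated F U"
    then obtain p where p: "p \<in> U" "p \<in> center_periodic F f"
      using x open_Int_closure_eq_empty[of U "center_periodic F f"] by blast
    then obtain k where k: "k \<ge> 1" "F ((f ^^ k) p) = F p" by (auto simp: center_periodic_def)
    then have "(f ^^ k) p \<in> U" using F[of "(f ^^ k) p"] U(3) p(1) by (auto simp: saturated_def)
    then show "\<exists>n\<ge>1. (f ^^ n) ` U \<inter> U \<noteq> {}" using k(1) p(1) by blast
  qed
qed

section \<open>One-dimensional manifolds\<close>

lemma subspace_dim_one: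
  fixes P :: "'e::euclidean_space set"
  assumes "DIM('e) = 1" "subspace P" "v \<in> P" "v \<noteq> 0"
  shows "P = UNIV"
proof -
  have "dim P \<noteq> 0" using assms(3,4) by auto
  then have "dim P = DIM('e)" using dim_subset_UNIV[of P] assms(1) by linarith
  then show ?thesis using assms(2) by (metis dim_eq_full span_eq_iff)
qed

text \<open>If the plaques were points, a curve in the leaf would be stationary.\<close>
lemma leaf_eq_UNIV_dim_one:
  fixes A :: "('a::metric_space, 'e::euclidean_space) chart set"
  assumes dim: "DIM('e) = 1" and con: "connected (UNIV :: 'a set)" and fol: "foliation A F"
    and v: "v \<in> leaf_tangent_space A F x" "v \<noteq> 0"
  shows "F y = UNIV"
proof -
  obtain P where P: "subspace P" "\<And>x. \<exists>U \<phi>. x \<in> U \<and> foliation_box A F P (U, \<phi>)"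
    using fol unfolding foliation_def by blast
  have F: "\<And>x. x \<in> F x" "\<And>x y. y \<in> F x \<Longrightarrow> F y = F x"
    using fol unfolding foliation_def by blast+
  have "P = UNIV"
  proof (rule ccontr)
    assume "P \<noteq> UNIV"
    then have P0: "P \<subseteq> {0}" using subspace_dim_one[OF dim P(1)] by blast
    obtain U \<phi> where U: "x \<in> U" "open U" "homeomorphism U (foliation_cube P) \<phi> (chart_inv (U, \<phi>))"
      "connected_component_set (F x \<inter> U) x = {y \<in> U. \<phi> y - \<phi> x \<in> P}"
      using P(2)[of x] unfolding foliation_box_def by auto
    \<comment> \<open>With \<open>P\<close> trivial a plaque is a single point, so a connected piece
      of the leaf inside the box cannot leave \<open>x\<close>.\<close>
    have comp: "connected_component_set (F x \<inter> U) x \<subseteq> {x}"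
    proof
      fix y assume "y \<in> connected_component_set (F x \<inter> U) x"
      then have "y \<in> U" "\<phi> y = \<phi> x" using U(4) P0 by auto
      then show "y \<in> {x}" using U(1,3) unfolding homeomorphism_def by (metis singletonI)
    qed
    obtain \<gamma> where \<gamma>: "C1_curve_on A \<gamma> 0 1" "\<gamma> ` {0..1} \<subseteq> F x" "\<gamma> 0 = x"
      "((\<lambda>s. snd (chart_at A x) (\<gamma> s)) has_vector_derivative v) (at 0 within {0..1})"
      using v(1) unfolding leaf_tangent_space_def by blast
    have cont: "continuous_on {0..1} \<gamma>" using \<gamma>(1) by (simp add: C1_curve_on_def)
    have "openin (top_of_set {0..1}) ({0..1} \<inter> \<gamma> -` U)"
      using continuous_openin_preimage_gen[OF cont U(2)] .
    moreover have "0 \<in> {0..1} \<inter> \<gamma> -` U" using U(1) \<gamma>(3) by simp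
    ultimately obtain e where e: "e > 0" "\<And>t. t \<in> {0..1} \<Longrightarrow> dist t 0 < e \<Longrightarrow> \<gamma> t \<in> U"
      unfolding openin_euclidean_subtopology_iff by blast
    define d where "d = min 1 (e/2)"
    have d: "0 < d" "d \<le> 1" "d < e" using e(1) by (auto simp: d_def)
    have "connected (\<gamma> ` {0..d})"
      using d cont by (intro connected_continuous_image) (auto elim: continuous_on_subset)
    moreover have "\<gamma> ` {0..d} \<subseteq> F x \<inter> U" using \<gamma>(2) e(2) d by (auto simp: dist_real_def)
    moreover have "x \<in> \<gamma> ` {0..d}" using \<gamma>(3) d by (metis atLeastAtMost_iff imageI less_imp_le order_refl)
    ultimately have "\<gamma> ` {0..d} \<subseteq> {x}"
      using connected_component_maximal comp by (metis subset_trans)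
    then have const: "\<gamma> s = x" if "s \<in> {0..d}" for s using that by blast
    have "((\<lambda>s. snd (chart_at A x) (\<gamma> s)) has_vector_derivative v) (at 0 within {0..d})"
      using \<gamma>(4) d by (auto intro: has_vector_derivative_within_subset)
    moreover have "((\<lambda>s. snd (chart_at A x) (\<gamma> s)) has_vector_derivative 0) (at 0 within {0..d})"
      by (rule has_vector_derivative_transform[where f = "\<lambda>_. snd (chart_at A x) x"])
        (use d const in auto)
    ultimately have "v = 0"
      using vector_derivative_unique_within_closed_interval[of 0 d 0] d by auto
    then show False using v(2) by simp
  qed
  \<comment> \<open>With \<open>P = UNIV\<close> a plaque fills its box, so leaves are open. The
    complement of a leaf is a union of leaves, hence leaves are also closed.\<close>
  have "\<exists>U. open U \<and> z \<in> U \<and> U \<subseteq> F z" for z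
  proof -
    obtain U \<phi> where U: "z \<in> U" "open U" "connected_component_set (F z \<inter> U) z = {y \<in> U. \<phi> y - \<phi> z \<in> P}"
      using P(2)[of z] unfolding foliation_box_def by auto
    then have "U \<subseteq> F z"
      using \<open>P = UNIV\<close> connected_component_subset[of "F z \<inter> U" z] by auto
    then show ?thesis using U by blast
  qed
  then have op: "open (F z)" for z
    unfolding open_subopen[of "F z"] by (metis F(2))
  have "- F y = (\<Union>z\<in>- F y. F z)"
    using F by (auto; metis)
  then have "open (- F y)" using op by (metis open_UN)
  then have "closed (F y)" by (simp add: closed_def)
  then show ?thesis
    using con op[of y] F(1)[of y] connected_clopen[of "UNIV :: 'a set"] by (auto simp: closedin_closed)
qed

text \<open>The rank of a continuous subbundle is locally constant.\<close>

lemma open_full_subbundle: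
  fixes A :: "('a::topological_space, 'e::euclidean_space) chart set"
  assumes "continuous_subbundle A E"
  shows "open {x. E x = UNIV}" "subspace (E x)"
proof -
  have *: "\<exists>U k. open U \<and> x \<in> U \<and> (\<forall>y\<in>U. subspace (E y) \<and> dim (E y) = k)" for x
    using assms subspace_span unfolding continuous_subbundle_def by metis
  then show "subspace (E x)" by blast
  show "open {x. E x = UNIV}"
  proof (subst open_subopen, intro ballI)
    fix x assume "x \<in> {x. E x = UNIV}"
    obtain U k where U: "open U" "x \<in> U" "\<forall>y\<in>U. subspace (E y) \<and> dim (E y) = k" using * by blast
    then have "k = DIM('e)" using \<open>x \<in> {x. E x = UNIV}\<close> by (metis (mono_tags) dim_UNIV mem_Collect_eq)
    then have "E y = UNIV" if "y \<in> U" for y using U(3) that by (metis dim_eq_full span_eq_iff)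
    then show "\<exists>T. open T \<and> x \<in> T \<and> T \<subseteq> {x. E x = UNIV}" using U by blast
  qed
qed

text \<open>At each point exactly one of \<open>Es\<close> and \<open>Eu\<close> is the full line:
  one by existence, only one by uniqueness of the decomposition. Both alternatives are open
  conditions, so connectedness selects one for all of \<open>M\<close>.\<close>

lemma splitting_dim_one:
  fixes A :: "('a::topological_space, 'e::euclidean_space) chart set"
  assumes dim: "DIM('e) = 1" and con: "connected (UNIV :: 'a set)"
    and split: "tangent_splitting A Es Ec Eu" and Ec: "\<And>x. Ec x \<subseteq> {0}"
  shows "(\<forall>x. Es x = UNIV) \<or> (\<forall>x. Eu x = UNIV)"
proof -
  have sub: "continuous_subbundle A Es" "continuous_subbundle A Eu" "continuous_subbundle A Ec"
    and uniq: "\<And>x v. \<exists>!(vs, vc, vu). vs \<in> Es x \<and> vc \<in> Ec x \<and> vu \<in> Eu x \<and> v = vs + vc + vu"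
    using split unfolding tangent_splitting_def by blast+
  obtain v :: 'e where v: "v \<noteq> 0" using nonzero_Basis SOME_Basis by blast
  have 1: "Es x = UNIV \<or> Eu x = UNIV" for x
  proof -
    obtain vs vc vu where "vs \<in> Es x" "vc \<in> Ec x" "vu \<in> Eu x" "v = vs + vc + vu"
      using uniq[of x v] by auto
    moreover from this have "vs \<noteq> 0 \<or> vu \<noteq> 0" using v Ec by force
    ultimately show ?thesis
      using subspace_dim_one[OF dim] open_full_subbundle(2) sub by metis
  qed
  have 2: "\<not> (Es x = UNIV \<and> Eu x = UNIV)" for x
  proof
    assume E: "Es x = UNIV \<and> Eu x = UNIV"
    have "0 \<in> Ec x" using open_full_subbundle(2)[OF sub(3)] subspace_0 by blast
    define Q where "Q = (\<lambda>(vs, vc, vu). vs \<in> Es x \<and> vc \<in> Ec x \<and> vu \<in> Eu x \<and> v = vs + vc + vu)"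
    have "\<exists>!t. Q t" using uniq[of x v] by (simp add: Q_def)
    moreover have "Q (v, 0, 0)" "Q (0, 0, v)" using E \<open>0 \<in> Ec x\<close> by (simp_all add: Q_def)
    ultimately have "(v, 0, 0) = (0::'e, 0::'e, v)" by blast
    then show False using v by simp
  qed
  have "{x. Es x = UNIV} = {} \<or> {x. Eu x = UNIV} = {}"
  proof -
    have "{x. Es x = UNIV} \<inter> {x. Eu x = UNIV} \<inter> UNIV = {}" using 2 by auto
    moreover have "UNIV \<subseteq> {x. Es x = UNIV} \<union> {x. Eu x = UNIV}" using 1 by auto
    ultimately show ?thesis
      using connectedD[OF con open_full_subbundle(1)[OF sub(1)] open_full_subbundle(1)[OF sub(2)]]
      by simp
  qed
  then show ?thesis
  proof
    assume "{x. Es x = UNIV} = {}"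
    then have "Eu x = UNIV" for x using 1[of x] by simp
    then show ?thesis by simp
  next
    assume "{x. Eu x = UNIV} = {}"
    then have "Es x = UNIV" for x using 1[of x] by simp
    then show ?thesis by simp
  qed
qed

section \<open>Differential calculus along piecewise C^1 curves\<close>

lemma chart_inv_chart:
  assumes "smooth_atlas A" "c \<in> A" "x \<in> fst c"
  shows "chart_inv c (snd c x) = x"
  using assms unfolding smooth_atlas_def homeomorphism_def by blast

lemma chart_at:
  assumes "smooth_atlas A"
  shows "chart_at A x \<in> A" "x \<in> fst (chart_at A x)"
proof -
  have "\<exists>c. c \<in> A \<and> x \<in> fst c" using atlas_chartE[OF assms] by metis
  then have "chart_at A x \<in> A \<and> x \<in> fst (chart_at A x)" unfolding chart_at_def by (rule someI_ex)
  then show "chart_at A x \<in> A" "x \<in> fst (chart_at A x)" by auto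
qed

text \<open>A single continuous derivative is required on all of the preimage of a target chart,
  whereas the chain rule gives a formula only locally, through some chart around
  \<open>\<beta> t0\<close>. Hence \<open>D\<close> is defined globally as a one-sided or two-sided
  vector derivative, and its continuity is checked locally.\<close>

lemma C1_curve_on_image:
  fixes A :: "('a::topological_space, 'e::euclidean_space) chart set"
  assumes atlas: "smooth_atlas A" and f: "C1_map A f" and \<beta>: "C1_curve_on A \<beta> a b" and "a < b"
  shows "C1_curve_on A (f \<circ> \<beta>) a b"
  unfolding C1_curve_on_def
proof (intro conjI ballI)
  have \<beta>cont: "continuous_on {a..b} \<beta>" using \<beta> by (simp add: C1_curve_on_def)
  have fcont: "continuous_on UNIV f" using f by (simp add: C1_map_def)
  show f\<beta>cont: "continuous_on {a..b} (f \<circ> \<beta>)"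
    using \<beta>cont fcont by (metis continuous_on_compose continuous_on_subset subset_UNIV)
  fix c' assume c': "c' \<in> A"
  define g where "g = (\<lambda>s. snd c' (f (\<beta> s)))"
  define T where "T = {a..b} \<inter> (f \<circ> \<beta>) -` fst c'"
  define D where "D = (\<lambda>t. vector_derivative g (at t within {a..b}))"
  have loc: "(g has_vector_derivative D t0) (at t0 within {a..b}) \<and> continuous (at t0 within T) D"
    if t0: "t0 \<in> T" for t0
  proof -
    obtain c where c: "c \<in> A" "\<beta> t0 \<in> fst c" "open (fst c)" using atlas_chartE[OF atlas] by metis
    define h where "h = snd c' \<circ> f \<circ> chart_inv c"
    define S where "S = snd c ` (fst c \<inter> f -` fst c')"
    define p where "p = (\<lambda>s. snd c (\<beta> s))"
    have "Ck_on 1 h S" using f c(1) c' by (simp add: C1_map_def h_def S_def)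
    then have h: "\<And>q. q \<in> S \<Longrightarrow> h differentiable (at q)"
      "\<And>v. continuous_on S (\<lambda>q. frechet_derivative h (at q) v)" by auto
    obtain D0 where D0: "continuous_on ({a..b} \<inter> \<beta> -` fst c) D0"
      "\<And>t. t \<in> {a..b} \<inter> \<beta> -` fst c \<Longrightarrow> (p has_vector_derivative D0 t) (at t within {a..b})"
      using \<beta> c(1) unfolding C1_curve_on_def p_def by blast
    have "openin (top_of_set {a..b}) ({a..b} \<inter> \<beta> -` fst c)"
      using continuous_openin_preimage_gen[OF \<beta>cont c(3)] .
    then obtain W where W: "open W" "{a..b} \<inter> \<beta> -` fst c = {a..b} \<inter> W"
      by (auto simp: openin_open)
    define N where "N = T \<inter> W"
    have NS: "p t \<in> S" if "t \<in> N" for t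
    proof -
      have "t \<in> {a..b} \<inter> \<beta> -` fst c" using that W(2) by (auto simp: N_def T_def)
      then show ?thesis using that by (auto simp: N_def T_def S_def p_def)
    qed
    have Nc: "t \<in> {a..b} \<inter> \<beta> -` fst c" if "t \<in> N" for t
      using that W(2) by (auto simp: N_def T_def)
    have der: "(g has_vector_derivative frechet_derivative h (at (p t)) (D0 t)) (at t within {a..b})"
      if t: "t \<in> N" for t
    proof -
      have "(p has_vector_derivative D0 t) (at t within {a..b} \<inter> W)"
        using D0(2)[OF Nc[OF t]] by (rule has_vector_derivative_within_subset) simp
      moreover have "(h has_derivative frechet_derivative h (at (p t))) (at (p t) within p ` ({a..b} \<inter> W))"
        using h(1)[OF NS[OF t]] by (simp add: frechet_derivative_works has_derivative_at_withinI)
      ultimately have "(h \<circ> p has_vector_derivative frechet_derivative h (at (p t)) (D0 t)) (at t within {a..b} \<inter> W)"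
        by (rule vector_derivative_diff_chain_within)
      moreover have "t \<in> {a..b} \<inter> W" using t by (auto simp: N_def T_def)
      moreover have "(h \<circ> p) s = g s" if "s \<in> {a..b} \<inter> W" for s
      proof -
        have "\<beta> s \<in> fst c" using that W(2) by blast
        then show ?thesis using chart_inv_chart[OF atlas c(1)] by (simp add: h_def p_def g_def)
      qed
      ultimately have "(g has_vector_derivative frechet_derivative h (at (p t)) (D0 t)) (at t within {a..b} \<inter> W)"
        by (intro has_vector_derivative_transform[of t "{a..b} \<inter> W" g "h \<circ> p"]) auto
      moreover have "at t within {a..b} = at t within {a..b} \<inter> W"
        by (rule at_within_nhd[of t W]) (use t W(1) in \<open>auto simp: N_def\<close>)
      ultimately show ?thesis by simp
    qed
    have Deq: "D t = frechet_derivative h (at (p t)) (D0 t)" if "t \<in> N" for t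
    proof -
      have "t \<in> {a..b}" using that by (simp add: N_def T_def)
      then show ?thesis
        unfolding D_def using vector_derivative_within_closed_interval[OF \<open>a < b\<close> _ der[OF that]] by simp
    qed
    have "t0 \<in> {a..b} \<inter> \<beta> -` fst c" using t0 c(2) by (simp add: T_def)
    then have t0N: "t0 \<in> N" unfolding W(2) using t0 by (simp add: N_def)
    \<comment> \<open>C^1 regularity gives continuity of the derivative in each fixed direction
      only; expanding \<open>D0 t\<close> in the basis reduces the varying direction to
      these.\<close>
    have "frechet_derivative h (at (p t)) (D0 t) =
        (\<Sum>i\<in>Basis. (D0 t \<bullet> i) *\<^sub>R frechet_derivative h (at (p t)) i)" if "t \<in> N" for t
    proof -
      let ?L = "frechet_derivative h (at (p t))"
      have lin: "linear ?L"
        using h(1)[OF NS[OF that]] by (rule linear_frechet_derivative)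
      have "?L (D0 t) = ?L (\<Sum>i\<in>Basis. (D0 t \<bullet> i) *\<^sub>R i)" by (simp add: euclidean_representation)
      also have "\<dots> = (\<Sum>i\<in>Basis. (D0 t \<bullet> i) *\<^sub>R ?L i)"
        by (simp only: linear_sum[OF lin] linear_scale[OF lin])
      finally show ?thesis .
    qed
    moreover have "continuous_on N (\<lambda>t. \<Sum>i\<in>Basis. (D0 t \<bullet> i) *\<^sub>R frechet_derivative h (at (p t)) i)"
    proof (intro continuous_intros)
      have sub: "N \<subseteq> {a..b} \<inter> \<beta> -` fst c" using Nc by blast
      show "continuous_on N D0" using D0(1) sub continuous_on_subset by blast
      have "continuous_on N p"
        unfolding continuous_on_eq_continuous_within
        using D0(2) sub by (meson continuous_within_subset has_vector_derivative_continuous inf.boundedE subsetD)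
      then show "continuous_on N (\<lambda>t. frechet_derivative h (at (p t)) i)" for i
        using continuous_on_compose2[OF h(2)] NS by blast
    qed
    ultimately have "continuous_on N D" using Deq by (simp cong: continuous_on_cong)
    then have "continuous (at t0 within N) D" using t0N by (simp add: continuous_on_eq_continuous_within)
    moreover have "at t0 within T = at t0 within N"
      by (rule at_within_nhd[of t0 W]) (use t0N W(1) in \<open>auto simp: N_def\<close>)
    ultimately have "continuous (at t0 within T) D" by (simp add: continuous_within)
    then show ?thesis using der[OF t0N] Deq[OF t0N] by simp
  qed
  then have "continuous_on T D" by (simp add: continuous_on_eq_continuous_within)
  then show "\<exists>D. continuous_on ({a..b} \<inter> (f \<circ> \<beta>) -` fst c') D \<and>
        (\<forall>t \<in> {a..b} \<inter> (f \<circ> \<beta>) -` fst c'.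
           ((\<lambda>s. snd c' ((f \<circ> \<beta>) s)) has_vector_derivative D t) (at t within {a..b}))"
    using loc by (intro exI[of _ D]) (auto simp: T_def g_def)
qed

lemma piecewise_C1_curve_image:
  fixes A :: "('a::topological_space, 'e::euclidean_space) chart set"
  assumes "smooth_atlas A" "C1_map A f" "piecewise_C1_curve A \<beta>"
  shows "piecewise_C1_curve A (f \<circ> \<beta>)"
proof -
  obtain n :: nat and t :: "nat \<Rightarrow> real" where t: "t 0 = 0" "t n = 1"
    "\<forall>i<n. t i < t (Suc i) \<and> C1_curve_on A \<beta> (t i) (t (Suc i))"
    using assms(3) unfolding piecewise_C1_curve_def by blast
  have "\<forall>i<n. t i < t (Suc i) \<and> C1_curve_on A (f \<circ> \<beta>) (t i) (t (Suc i))"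
    using t(3) C1_curve_on_image[OF assms(1,2)] by simp
  then show ?thesis using t(1,2) unfolding piecewise_C1_curve_def by (intro exI conjI)
qed

lemma piecewise_C1_curve_funpow:
  fixes A :: "('a::topological_space, 'e::euclidean_space) chart set"
  assumes "smooth_atlas A" "C1_map A f" "piecewise_C1_curve A \<beta>"
  shows "piecewise_C1_curve A ((f ^^ n) \<circ> \<beta>)"
proof (induction n)
  case (Suc n)
  have "piecewise_C1_curve A (f \<circ> ((f ^^ n) \<circ> \<beta>))"
    using piecewise_C1_curve_image[OF assms(1,2) Suc] .
  then show ?case by (simp add: o_def)
qed (use assms(3) in simp)

text \<open>Pointwise differentiability suffices for the chain rule on velocities and passes easily
  to powers of \<open>f\<close>. Continuity of the derivatives of image curves is obtained
  separately, by applying \<open>f\<close> once at a time.\<close>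

definition chart_differentiable ::
  "('a::topological_space, 'e::euclidean_space) chart set \<Rightarrow> ('a \<Rightarrow> 'a) \<Rightarrow> bool" where
  "chart_differentiable A f \<longleftrightarrow> continuous_on UNIV f \<and>
     (\<forall>c\<in>A. \<forall>c'\<in>A. \<forall>x\<in>fst c. f x \<in> fst c' \<longrightarrow>
        (snd c' \<circ> f \<circ> chart_inv c) differentiable (at (snd c x)))"

lemma C1_map_chart_differentiable: "C1_map A f \<Longrightarrow> chart_differentiable A f"
  unfolding C1_map_def chart_differentiable_def by (auto simp: image_iff)

lemma chart_differentiable_id:
  assumes "smooth_atlas A"
  shows "chart_differentiable A id"
  unfolding chart_differentiable_def
proof (intro conjI ballI impI)
  fix c c' x assume c: "c \<in> A" "c' \<in> A" "x \<in> fst c" "id x \<in> fst c'"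
  have "Ck_on 1 (snd c' \<circ> chart_inv c) (snd c ` (fst c \<inter> fst c'))"
    using assms c(1,2) unfolding smooth_atlas_def smooth_on_def by blast
  then show "(snd c' \<circ> id \<circ> chart_inv c) differentiable (at (snd c x))" using c(3,4) by auto
qed simp

lemma chart_differentiable_comp:
  fixes A :: "('a::topological_space, 'e::euclidean_space) chart set"
  assumes atlas: "smooth_atlas A" and f: "chart_differentiable A f" and g: "chart_differentiable A g"
  shows "chart_differentiable A (f \<circ> g)"
  unfolding chart_differentiable_def
proof (intro conjI ballI impI)
  have gc: "continuous_on UNIV g" and fc: "continuous_on UNIV f"
    using f g by (auto simp: chart_differentiable_def)
  then show "continuous_on UNIV (f \<circ> g)"
    by (metis continuous_on_compose continuous_on_subset subset_UNIV)
  fix c c' x assume c: "c \<in> A" "c' \<in> A" "x \<in> fst c" "(f \<circ> g) x \<in> fst c'"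
  obtain b where b: "b \<in> A" "g x \<in> fst b" "open (fst b)" using atlas_chartE[OF atlas] by metis
  let ?p = "snd c x" and ?G = "snd b \<circ> g \<circ> chart_inv c" and ?F = "snd c' \<circ> f \<circ> chart_inv b"
  have px: "chart_inv c ?p = x" using chart_inv_chart[OF atlas c(1,3)] .
  have "?G differentiable (at ?p)" using g c b unfolding chart_differentiable_def by blast
  moreover have "?G ?p = snd b (g x)" using px by simp
  moreover have "?F differentiable (at (snd b (g x)))"
    using f c(2,4) b unfolding chart_differentiable_def by simp
  ultimately have "(?F \<circ> ?G) differentiable (at ?p)"
    by (intro differentiable_chain_at) simp_all
  then obtain L where L: "((?F \<circ> ?G) has_derivative L) (at ?p)" unfolding differentiable_def by blast
  \<comment> \<open>The two coordinate expressions agree only where \<open>g\<close> maps into the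
    intermediate chart \<open>b\<close>, so this has to be a neighbourhood.\<close>
  have "open (g -` fst b)" using gc b(3) by (simp add: continuous_on_open_vimage)
  then have op: "open (snd c ` (fst c \<inter> g -` fst b))" using open_chart_image[OF atlas c(1)] by blast
  have "(snd c' \<circ> (f \<circ> g) \<circ> chart_inv c has_derivative L) (at ?p)"
  proof (rule has_derivative_transform_within_open[OF L op])
    show "?p \<in> snd c ` (fst c \<inter> g -` fst b)" using c(3) b(2) by simp
    fix q assume "q \<in> snd c ` (fst c \<inter> g -` fst b)"
    then obtain y where y: "y \<in> fst c" "g y \<in> fst b" "q = snd c y" by blast
    then show "(?F \<circ> ?G) q = (snd c' \<circ> (f \<circ> g) \<circ> chart_inv c) q"
      using chart_inv_chart[OF atlas c(1) y(1)] chart_inv_chart[OF atlas b(1) y(2)] by simp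
  qed
  then show "(snd c' \<circ> (f \<circ> g) \<circ> chart_inv c) differentiable (at ?p)"
    unfolding differentiable_def by blast
qed

lemma chart_differentiable_funpow:
  assumes "smooth_atlas A" "chart_differentiable A f"
  shows "chart_differentiable A (f ^^ n)"
proof (induction n)
  case 0
  show ?case using chart_differentiable_id[OF assms(1)] by (simp add: id_def)
next
  case (Suc n)
  show ?case using chart_differentiable_comp[OF assms Suc] by (simp add: o_def)
qed

lemma velocity_image:
  fixes A :: "('a::topological_space, 'e::euclidean_space) chart set"
  assumes atlas: "smooth_atlas A" and F: "chart_differentiable A F"
    and \<beta>: "C1_curve_on A \<beta> a b" and t: "t \<in> {a<..<b}"
  shows "velocity A (F \<circ> \<beta>) t = tangent_map A F (\<beta> t) (velocity A \<beta> t)"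
proof -
  define c where "c = chart_at A (\<beta> t)"
  define c' where "c' = chart_at A (F (\<beta> t))"
  have c: "c \<in> A" "\<beta> t \<in> fst c" and c': "c' \<in> A" "F (\<beta> t) \<in> fst c'"
    using chart_at[OF atlas] by (simp_all add: c_def c'_def)
  have opc: "open (fst c)" using atlas c(1) unfolding smooth_atlas_def by blast
  define p where "p = (\<lambda>s. snd c (\<beta> s))"
  define h where "h = snd c' \<circ> F \<circ> chart_inv c"
  obtain w where w: "(p has_vector_derivative w) (at t within {a..b})"
    using \<beta> c t unfolding C1_curve_on_def p_def by fastforce
  have "at t within {a..b} = at t" using t by (intro at_within_interior) simp
  then have p: "(p has_vector_derivative w) (at t)" using w by simp
  then have vel: "velocity A \<beta> t = w"
    unfolding velocity_def c_def[symmetric] p_def[symmetric] by (rule vector_derivative_at)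
  have "h differentiable (at (p t))"
    using F c c' unfolding chart_differentiable_def h_def p_def by blast
  then have "(h has_derivative frechet_derivative h (at (p t))) (at (p t))"
    by (simp add: frechet_derivative_works)
  then have "(h \<circ> p has_vector_derivative frechet_derivative h (at (p t)) w) (at t)"
    using vector_derivative_diff_chain_within[of p w t UNIV h] p by (simp add: has_derivative_at_withinI)
  note der = this
  have "continuous_on {a<..<b} \<beta>"
    using \<beta> unfolding C1_curve_on_def
    by (elim conjE continuous_on_subset) (simp add: greaterThanLessThan_subseteq_atLeastAtMost_iff)
  then have op: "open ({a<..<b} \<inter> \<beta> -` fst c)"
    by (rule continuous_open_preimage) (simp_all add: opc)
  have "((\<lambda>s. snd c' (F (\<beta> s))) has_vector_derivative frechet_derivative h (at (p t)) w) (at t)"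
  proof (rule has_vector_derivative_transform_within_open[OF der op])
    show "t \<in> {a<..<b} \<inter> \<beta> -` fst c" using c(2) t by simp
    fix s assume "s \<in> {a<..<b} \<inter> \<beta> -` fst c"
    then show "(h \<circ> p) s = snd c' (F (\<beta> s))"
      using chart_inv_chart[OF atlas c(1)] by (simp add: h_def p_def)
  qed
  then have "velocity A (F \<circ> \<beta>) t = frechet_derivative h (at (p t)) w"
    unfolding velocity_def o_apply c'_def[symmetric] by (rule vector_derivative_at)
  then show ?thesis by (simp add: vel tangent_map_def h_def p_def c_def c'_def)
qed

lemma piecewise_velocity_image:
  fixes A :: "('a::topological_space, 'e::euclidean_space) chart set"
  assumes "smooth_atlas A" "chart_differentiable A F" "piecewise_C1_curve A \<beta>"
  shows "\<exists>X. finite X \<and> (\<forall>t\<in>{0..1} - X.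
           velocity A (F \<circ> \<beta>) t = tangent_map A F (\<beta> t) (velocity A \<beta> t))"
proof -
  obtain n :: nat and u :: "nat \<Rightarrow> real" where u: "u 0 = 0" "u n = 1"
    "\<forall>i<n. u i < u (Suc i) \<and> C1_curve_on A \<beta> (u i) (u (Suc i))"
    using assms(3) unfolding piecewise_C1_curve_def by blast
  have "velocity A (F \<circ> \<beta>) t = tangent_map A F (\<beta> t) (velocity A \<beta> t)"
    if t: "t \<in> {0..1} - u ` {..n}" for t
  proof -
    \<comment> \<open>The last break point not after \<open>t\<close>. As \<open>t\<close> is no
      break point itself, it lies inside the open piece that follows, where \<open>velocity\<close>
      is a genuine two-sided derivative.\<close>
    define i where "i = Max {i. i \<le> n \<and> u i \<le> t}"
    have fin: "finite {i. i \<le> n \<and> u i \<le> t}" by simp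
    have "0 \<in> {i. i \<le> n \<and> u i \<le> t}" using t u(1) by simp
    then have i: "i \<le> n" "u i \<le> t" using Max_in[OF fin] unfolding i_def by blast+
    have "u i \<noteq> t" using t i(1) by auto
    moreover have "i \<noteq> n" using i(2) \<open>u i \<noteq> t\<close> t u(2) by auto
    moreover have "\<not> u (Suc i) \<le> t"
    proof
      assume "u (Suc i) \<le> t"
      then have "Suc i \<in> {i. i \<le> n \<and> u i \<le> t}" using i(1) \<open>i \<noteq> n\<close> by simp
      then have "Suc i \<le> i" using Max_ge[OF fin] unfolding i_def by blast
      then show False by simp
    qed
    ultimately have "i < n" "t \<in> {u i<..<u (Suc i)}" using i by auto
    then show ?thesis using velocity_image[OF assms(1,2)] u(3) by blast
  qed
  then show ?thesis by (intro exI[of _ "u ` {..n}"]) simp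
qed

section \<open>Contraction of lengths and distances\<close>

lemma tnorm_nonneg:
  assumes "riemannian_metric A G"
  shows "tnorm G x v \<ge> 0"
proof -
  have "bilinear (G x)" "v \<noteq> 0 \<Longrightarrow> G x v v > 0"
    using assms unfolding riemannian_metric_def by blast+
  then have "G x v v \<ge> 0" by (cases "v = 0") (auto simp: bilinear_lzero)
  then show ?thesis by (simp add: tnorm_def)
qed

text \<open>Integrability of the speed of \<open>\<gamma>\<close> need not be proved: the length of \<open>\<gamma>\<close> is at least
  \<open>dist x y > 0\<close>, whereas a non-integrable speed would have integral zero.\<close>
lemma dist_image_le:
  fixes A :: "('a::metric_space, 'e::euclidean_space) chart set"
  assumes M: "closed_riemannian_manifold A G"
    and pw: "\<And>\<gamma>. piecewise_C1_curve A \<gamma> \<Longrightarrow> piecewise_C1_curve A (\<Phi> \<circ> \<gamma>)"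
    and speed: "\<And>\<gamma>. piecewise_C1_curve A \<gamma> \<Longrightarrow> \<exists>X. finite X \<and> (\<forall>t\<in>{0..1} - X.
       tnorm G (\<Phi> (\<gamma> t)) (velocity A (\<Phi> \<circ> \<gamma>) t) \<le> L * tnorm G (\<gamma> t) (velocity A \<gamma> t))"
    and "L \<ge> 0"
  shows "dist (\<Phi> x) (\<Phi> y) \<le> L * dist x y"
proof (cases "x = y")
  case False
  have d: "intrinsic_dist A G UNIV x y = ereal (dist x y)" for x y
    using M by (simp add: closed_riemannian_manifold_def)
  have nn: "tnorm G x v \<ge> 0" for x v
    using M tnorm_nonneg[of A G] by (simp add: closed_riemannian_manifold_def)
  have len: "dist u v \<le> curve_length A G \<gamma>" if "piecewise_C1_curve A \<gamma>" "\<gamma> 0 = u" "\<gamma> 1 = v" for \<gamma> u v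
  proof -
    have "intrinsic_dist A G UNIV u v \<le> ereal (curve_length A G \<gamma>)"
      unfolding intrinsic_dist_def by (rule INF_lower) (use that in simp)
    then show ?thesis by (simp add: d)
  qed
  have "dist (\<Phi> x) (\<Phi> y) \<le> L * curve_length A G \<gamma>"
    if \<gamma>: "piecewise_C1_curve A \<gamma>" "\<gamma> 0 = x" "\<gamma> 1 = y" for \<gamma>
  proof -
    define S where "S = (\<lambda>t. tnorm G (\<gamma> t) (velocity A \<gamma> t))"
    define S' where "S' = (\<lambda>t. tnorm G (\<Phi> (\<gamma> t)) (velocity A (\<Phi> \<circ> \<gamma>) t))"
    have "integral {0..1} S \<noteq> 0"
      using len[OF \<gamma>] False unfolding curve_length_def S_def by auto
    then have int: "S integrable_on {0..1}" using not_integrable_integral by blast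
    have "integral {0..1} S' \<le> L * integral {0..1} S"
    \<comment> \<open>If the speed of the image curve is not integrable, its integral is 0 by
      convention and the bound is immediate.\<close>
    proof (cases "S' integrable_on {0..1}")
      case True
      obtain X where X: "finite X" "\<And>t. t \<in> {0..1} - X \<Longrightarrow> S' t \<le> L * S t"
        using speed[OF \<gamma>(1)] unfolding S_def S'_def by blast
      define S'' where "S'' = (\<lambda>t. if t \<in> X then 0 else S' t)"
      have "(S'' has_integral integral {0..1} S') {0..1}"
        by (rule has_integral_spike_finite[OF X(1) _ integrable_integral[OF True]]) (simp add: S''_def)
      moreover have "((\<lambda>t. L * S t) has_integral L * integral {0..1} S) {0..1}"
        using has_integral_mult_right[OF integrable_integral[OF int]] .
      moreover have "S'' t \<le> L * S t" if "t \<in> {0..1}" for t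
        using X(2)[of t] that nn \<open>L \<ge> 0\<close> by (auto simp: S''_def S_def)
      ultimately show ?thesis using has_integral_le by blast
    next
      case False
      have "integral {0..1} S \<ge> 0" using int nn by (intro integral_nonneg) (auto simp: S_def)
      then show ?thesis using not_integrable_integral[OF False] \<open>L \<ge> 0\<close> by simp
    qed
    moreover have "dist (\<Phi> x) (\<Phi> y) \<le> integral {0..1} S'"
      using len[OF pw[OF \<gamma>(1)]] \<gamma>(2,3) by (simp add: curve_length_def S'_def)
    ultimately show ?thesis by (simp add: curve_length_def S_def)
  qed
  moreover have "\<exists>\<gamma>. piecewise_C1_curve A \<gamma> \<and> \<gamma> 0 = x \<and> \<gamma> 1 = y \<and> curve_length A G \<gamma> < dist x y + e"
    if "e > 0" for e
  proof -
    have "intrinsic_dist A G UNIV x y < ereal (dist x y + e)" using that by (simp add: d)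
    then show ?thesis unfolding intrinsic_dist_def by (auto simp: INF_less_iff)
  qed
  ultimately have "dist (\<Phi> x) (\<Phi> y) \<le> L * (dist x y + e)" if "e > 0" for e
    using that \<open>L \<ge> 0\<close> by (meson less_imp_le mult_left_mono order_trans)
  then have *: "dist (\<Phi> x) (\<Phi> y) \<le> L * dist x y + L * e" if "e > 0" for e
    using that by (simp add: distrib_left)
  show ?thesis
  proof (rule field_le_epsilon)
    fix e :: real assume "e > 0"
    \<comment> \<open>Dividing by \<open>L + 1\<close> also covers \<open>L = 0\<close>.\<close>
    have "L * (e / (L + 1)) \<le> e" using \<open>L \<ge> 0\<close> \<open>e > 0\<close> by (simp add: field_simps)
    moreover have "dist (\<Phi> x) (\<Phi> y) \<le> L * dist x y + L * (e / (L + 1))"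
      using \<open>L \<ge> 0\<close> \<open>e > 0\<close> by (intro *) simp
    ultimately show "dist (\<Phi> x) (\<Phi> y) \<le> L * dist x y + e" by linarith
  qed
qed simp

text \<open>The diameter is attained, say at \<open>a\<close> and \<open>b\<close>. Preimages of
  these would be at least twice as far apart, so the diameter is 0.\<close>

lemma surj_contraction_compact:
  fixes \<Phi> :: "'a::metric_space \<Rightarrow> 'a"
  assumes "compact (UNIV :: 'a set)" "surj \<Phi>" "\<And>x y. dist (\<Phi> x) (\<Phi> y) \<le> 1/2 * dist x y"
  shows "x = (y :: 'a)"
proof -
  obtain a b :: 'a where ab: "\<And>u v :: 'a. dist u v \<le> dist a b"
    using compact_sup_maxdistance[OF assms(1) UNIV_not_empty] by blast
  obtain a' b' where "a = \<Phi> a'" "b = \<Phi> b'" using assms(2) by (meson surjD)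
  then have "dist a b \<le> 1/2 * dist a' b'" using assms(3)[of a' b'] by simp
  then have "dist a b \<le> 1/2 * dist a b" using ab[of a' b'] by linarith
  then have "dist a b = 0" using zero_le_dist[of a b] by linarith
  then have "dist x y = 0" using ab[of x y] by simp
  then show ?thesis by simp
qed

lemma no_uniform_hyperbolicity_dim_one:
  fixes A :: "('a::metric_space, 'e::euclidean_space) chart set"
  assumes M: "closed_riemannian_manifold A G" and f: "diffeomorphism A f"
    and ph: "partially_hyperbolic A G f Es Ec Eu"
    and E: "(\<forall>x. Es x = UNIV) \<or> (\<forall>x. Eu x = UNIV)"
  shows "x = (y::'a)"
proof -
  have atlas: "smooth_atlas A" and comp: "compact (UNIV :: 'a set)"
    using M by (auto simp: closed_riemannian_manifold_def)
  have C1: "C1_map A f" "C1_map A (inv f)" and bij: "bij f" using f by (auto simp: diffeomorphism_def)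
  have vel: "\<exists>X. finite X \<and> (\<forall>t\<in>{0..1} - X.
      velocity A ((f ^^ n) \<circ> \<beta>) t = tangent_map A (f ^^ n) (\<beta> t) (velocity A \<beta> t))"
    if "piecewise_C1_curve A \<beta>" for \<beta> n
    by (rule piecewise_velocity_image[OF atlas chart_differentiable_funpow[OF atlas
          C1_map_chart_differentiable[OF C1(1)]] that])
  obtain \<nu> \<gamma>' \<gamma> \<mu> C :: real where c: "\<nu> < \<gamma>'" "\<gamma>' < 1" "1 < \<gamma>" "\<gamma> < \<mu>" "C \<ge> 1" and
    hyp: "\<forall>x. \<forall>n>0.
      (\<forall>v \<in> Es x. tnorm G ((f ^^ n) x) (tangent_map A (f ^^ n) x v) \<le> C * \<nu> ^ n * tnorm G x v) \<and>
      (\<forall>v \<in> Ec x.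
         inverse C * \<gamma>' ^ n * tnorm G x v \<le> tnorm G ((f ^^ n) x) (tangent_map A (f ^^ n) x v) \<and>
         tnorm G ((f ^^ n) x) (tangent_map A (f ^^ n) x v) \<le> C * \<gamma> ^ n * tnorm G x v) \<and>
      (\<forall>v \<in> Eu x.
         inverse C * \<mu> ^ n * tnorm G x v \<le> tnorm G ((f ^^ n) x) (tangent_map A (f ^^ n) x v))"
    using ph[unfolded partially_hyperbolic_def, THEN conjunct2, THEN conjunct2]
    by (elim exE conjE)
  have nn: "tnorm G x v \<ge> 0" for x v
    using M tnorm_nonneg[of A G] by (simp add: closed_riemannian_manifold_def)
  have hyp_s: "tnorm G ((f ^^ n) x) (tangent_map A (f ^^ n) x v) \<le> C * \<nu> ^ n * tnorm G x v"
    if "n > 0" "v \<in> Es x" for n x v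
    using conjunct1[OF hyp[rule_format, OF that(1)]] that(2) by (rule bspec)
  have hyp_u: "inverse C * \<mu> ^ n * tnorm G x v \<le> tnorm G ((f ^^ n) x) (tangent_map A (f ^^ n) x v)"
    if "n > 0" "v \<in> Eu x" for n x v
    using conjunct2[OF conjunct2[OF hyp[rule_format, OF that(1)]]] that(2) by (rule bspec)
  from E show ?thesis
  proof
    assume Es: "\<forall>x. Es x = UNIV"
    obtain n where n: "n > 0" "C * \<nu> ^ n \<le> 1/2"
    \<comment> \<open>The rate \<open>\<nu>\<close> has no prescribed sign. If it is positive, a
      large power absorbs \<open>C\<close>; otherwise the first power already gives a nonpositive
      factor.\<close>
    proof (cases "\<nu> > 0")
      case True
      obtain n where n: "\<nu> ^ n < 1 / (2 * C)"
        using real_arch_pow_inv[of "1 / (2 * C)" \<nu>] c by auto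
      moreover have "n > 0" using n c by (intro gr0I) (auto simp: field_simps)
      ultimately show ?thesis using that[of n] c by (simp add: field_simps)
    next
      case False
      then have "C * \<nu> ^ 1 \<le> 0" using c by (simp add: mult_nonneg_nonpos)
      then show ?thesis using that[of 1] by simp
    qed
    have "dist ((f ^^ n) u) ((f ^^ n) v) \<le> 1/2 * dist u v" for u v
    proof (rule dist_image_le[OF M])
      fix \<gamma> assume \<gamma>: "piecewise_C1_curve A \<gamma>"
      show "piecewise_C1_curve A ((f ^^ n) \<circ> \<gamma>)" by (rule piecewise_C1_curve_funpow[OF atlas C1(1) \<gamma>])
      have "tnorm G ((f ^^ n) p) (tangent_map A (f ^^ n) p w) \<le> 1/2 * tnorm G p w" for p w
        using hyp_s[OF n(1), of w p] Es mult_right_mono[OF n(2) nn[of p w]] by auto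
      then show "\<exists>X. finite X \<and> (\<forall>t\<in>{0..1} - X.
         tnorm G ((f ^^ n) (\<gamma> t)) (velocity A ((f ^^ n) \<circ> \<gamma>) t) \<le> 1/2 * tnorm G (\<gamma> t) (velocity A \<gamma> t))"
        using vel[OF \<gamma>, of n] by metis
    qed simp
    moreover have "surj (f ^^ n)" using bij by (simp add: bij_is_surj surj_fn)
    ultimately show ?thesis using surj_contraction_compact[OF comp] by blast
  next
    assume Eu: "\<forall>x. Eu x = UNIV"
    obtain n where n: "2 * C < \<mu> ^ n" using real_arch_pow[of \<mu> "2 * C"] c by auto
    have n0: "n > 0" using n c by (intro gr0I) auto
    have n2: "2 \<le> inverse C * \<mu> ^ n" using n c by (simp add: field_simps)
    define \<Phi> where "\<Phi> = (inv f) ^^ n"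
    have f\<Phi>: "(f ^^ n) (\<Phi> z) = z" for z
      unfolding \<Phi>_def using bij by (metis bij_is_surj comp_apply fn_o_inv_fn_is_id)
    have \<Phi>f: "\<Phi> ((f ^^ n) z) = z" for z
      unfolding \<Phi>_def using bij by (metis bij_is_inj comp_apply inv_fn_o_fn_is_id)
    have "dist (\<Phi> u) (\<Phi> v) \<le> 1/2 * dist u v" for u v
    proof (rule dist_image_le[OF M])
      fix \<gamma> assume \<gamma>: "piecewise_C1_curve A \<gamma>"
      show pw: "piecewise_C1_curve A (\<Phi> \<circ> \<gamma>)"
        unfolding \<Phi>_def by (rule piecewise_C1_curve_funpow[OF atlas C1(2) \<gamma>])
      have "tnorm G p w \<le> 1/2 * tnorm G ((f ^^ n) p) (tangent_map A (f ^^ n) p w)" for p w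
        using hyp_u[OF n0, of w p] Eu mult_right_mono[OF n2 nn[of p w]] by auto
      \<comment> \<open>Expansion under \<open>f ^^ n\<close>, applied to the velocities of
        \<open>\<Phi> \<circ> \<gamma>\<close>, reads as contraction under \<open>\<Phi>\<close>;
        the tangent map of the inverse never enters.\<close>
      moreover have "(f ^^ n) \<circ> (\<Phi> \<circ> \<gamma>) = \<gamma>" using f\<Phi> by (simp add: fun_eq_iff)
      moreover obtain X where "finite X" "\<forall>t\<in>{0..1} - X.
        velocity A ((f ^^ n) \<circ> (\<Phi> \<circ> \<gamma>)) t =
          tangent_map A (f ^^ n) ((\<Phi> \<circ> \<gamma>) t) (velocity A (\<Phi> \<circ> \<gamma>) t)"
        using vel[OF pw, of n] by blast
      ultimately show "\<exists>X. finite X \<and> (\<forall>t\<in>{0..1} - X.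
         tnorm G (\<Phi> (\<gamma> t)) (velocity A (\<Phi> \<circ> \<gamma>) t) \<le> 1/2 * tnorm G (\<gamma> t) (velocity A \<gamma> t))"
        using f\<Phi> by (metis comp_apply)
    qed simp
    moreover have "surj \<Phi>" using \<Phi>f by (metis surjI)
    ultimately show ?thesis using surj_contraction_compact[OF comp] by blast
  qed
qed

theorem theorem6:
  fixes A :: "('a::metric_space, 'e::euclidean_space) chart set"
    and G :: "'a \<Rightarrow> 'e \<Rightarrow> 'e \<Rightarrow> real"
    and f :: "'a \<Rightarrow> 'a"
    and Es Ec Eu :: "'a \<Rightarrow> 'e set"
    and Fc :: "'a \<Rightarrow> 'a set"
  assumes "closed_riemannian_manifold A G"
    and "diffeomorphism A f"
    and "partially_hyperbolic A G f Es Ec Eu"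
    and "center_foliation A f Ec Fc"
    and "expansive_wrt A G Fc f"
    and "topologically_stable_wrt A G Fc f"
  shows "center_chain_recurrent A G Fc f \<subseteq> closure (center_periodic Fc f)
       \<and> closure (center_periodic Fc f) \<subseteq> center_nonwandering Fc f"
proof
  have M: "smooth_atlas A" "riemannian_metric A G" "compact (UNIV :: 'a set)" "connected (UNIV :: 'a set)"
    using assms(1) by (auto simp: closed_riemannian_manifold_def)
  have fol: "foliation A Fc" and tangent: "\<And>x. leaf_tangent_space A Fc x = Ec x"
    and inv: "\<And>x. f ` Fc x = Fc (f x)"
    using assms(4) by (auto simp: center_foliation_def)
  have F: "\<And>x. x \<in> Fc x" "\<And>x y. y \<in> Fc x \<Longrightarrow> Fc y = Fc x"
    using fol unfolding foliation_def by blast+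
  show "closure (center_periodic Fc f) \<subseteq> center_nonwandering Fc f"
    using F(1) by (rule closure_periodic_subset_nonwandering)
  have homeo: "homeomorphism UNIV UNIV f (inv f)"
    using assms(2) unfolding diffeomorphism_def C1_map_def
    by (intro homeomorphismI) (auto simp: bij_is_inj bij_is_surj surj_f_inv_f)
  show "center_chain_recurrent A G Fc f \<subseteq> closure (center_periodic Fc f)"
  proof
    fix x assume "x \<in> center_chain_recurrent A G Fc f"
    then have chain: "leaf_chain A G Fc f \<delta> x x" if "\<delta> > 0" for \<delta>
      using that by (simp add: center_chain_recurrent_def)
    consider "DIM('e) \<ge> 2" | "DIM('e) = 1" using DIM_positive[where 'a = 'e] by linarith
    then show "x \<in> closure (center_periodic Fc f)"
    proof cases
      case 1
      show ?thesis
      proof (rule stable_closing[OF compact_imp_bounded[OF M(3)] F inv assms(6)])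
        fix \<epsilon> :: real assume "\<epsilon> > 0"
        obtain \<delta> where \<delta>: "\<delta> > 0"
          "\<forall>(I::nat set) (x::nat \<Rightarrow> 'a) y. finite I \<longrightarrow> inj_on x I \<longrightarrow> inj_on y I \<longrightarrow>
             (\<forall>i\<in>I. dist (x i) (y i) < \<delta>) \<longrightarrow>
             (\<exists>h k. homeomorphism UNIV UNIV h k \<and> (\<forall>i\<in>I. h (x i) = y i) \<and> (\<forall>z. dist z (h z) \<le> \<epsilon>))"
          using manifold_move_points[OF M(1,3) 1 \<open>\<epsilon> > 0\<close>] by (elim exE conjE)
        \<comment> \<open>A third, because a leaf chain with constant \<open>\<delta> / 3\<close> is
          a pseudo-orbit with jumps below three times that constant.\<close>
        have \<delta>3: "\<delta> / 3 > 0" using \<delta>(1) by simp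
        obtain r z where z: "r \<ge> 1" "z 0 = x" "z r = x"
          "\<forall>i<r. dist (f (z i)) (z (Suc i)) < 3 * (\<delta> / 3)"
          using chain_imp_pseudo_cycle[OF assms(1) F(1) chain[OF \<delta>3] \<delta>3] by (elim exE conjE)
        then have step: "dist (f (z i)) (z (Suc i)) < \<delta>" if "i < r" for i using that by simp
        show "\<exists>g k n. homeomorphism UNIV UNIV g k \<and> (\<forall>y. dist (f y) (g y) \<le> \<epsilon>) \<and> n \<ge> 1 \<and> (g ^^ n) x = x"
        proof (rule homeomorphism_closing[OF _ homeo z(1-3) step])
          fix I :: "nat set" and u v :: "nat \<Rightarrow> 'a"
          assume "finite I" "inj_on u I" "inj_on v I" "\<And>i. i \<in> I \<Longrightarrow> dist (u i) (v i) < \<delta>"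
          then show "\<exists>h k. homeomorphism UNIV UNIV h k \<and> (\<forall>i\<in>I. h (u i) = v i) \<and> (\<forall>z. dist z (h z) \<le> \<epsilon>)"
            by (intro \<delta>(2)[rule_format])
        qed
      qed
    next
      case 2
      show ?thesis
      proof (cases "\<forall>x. Ec x \<subseteq> {0}")
        case True
        have "tangent_splitting A Es Ec Eu" using assms(3) by (simp add: partially_hyperbolic_def)
        then have "(\<forall>x. Es x = UNIV) \<or> (\<forall>x. Eu x = UNIV)"
          using splitting_dim_one[OF 2 M(4)] True by blast
        then have "UNIV \<subseteq> {x}"
          using no_uniform_hyperbolicity_dim_one[OF assms(1-3)] by auto
        then have "ball x 1 \<subseteq> {x}" by blast
        then have "finite (ball x 1)" by (rule finite_subset) simp
        then show ?thesis using infinite_ball_manifold[OF M(1), of 1 x] by simp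
      next
        case False
        then obtain x' v where "v \<in> leaf_tangent_space A Fc x'" "v \<noteq> 0" using tangent by blast
        then have "Fc y = UNIV" for y by (rule leaf_eq_UNIV_dim_one[OF 2 M(4) fol])
        then have "x \<in> center_periodic Fc f" by (auto simp: center_periodic_def)
        then show ?thesis using closure_subset by blast
      qed
    qed
  qed
qed

end
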